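(* Let $n=|Ag|\geq 1$ and $\mathsf{X}\subseteq\{\mathbf{D2},\mathbf{D3},\mathbf{D4},\mathbf{D5}\}$. A sequent $\Lambda$ is derivable in the calculus $\mathsf{G3DS}_{n}\mathsf{X}$ if and only if $\Lambda$ is valid relative to $\mathsf{DS}_{n}\mathsf{X}$.
   Context: Language $\mathcal{L}_n$: $Ag=\{1,\dots,n\}$ is a finite set of agents, $Atm$ a countable set of atoms; formulas (in negation normal form) are $\phi::=p\mid\neg p\mid\phi\lor\phi\mid\phi\land\phi\mid\Box\phi\mid\Diamond\phi\mid[i]\phi\mid\langle i\rangle\phi\mid\otimes_i\phi\mid\ominus_i\phi$ with $i\in Ag$, $p\in Atm$. Frames: a $\mathsf{DS}_n$-frame is $\langle W,R_\Box,\{R_{[i]}\}_{i\in Ag},\{R_{\otimes_i}\}_{i\in Ag}\rangle$ with $W\neq\emptyset$, all relations binary on $W$, $R_\alpha(w)=\{v:(w,v)\in R_\alpha\}$, such that: (C1) $R_\Box$ is an equivalence relation; (C2) each $R_{[i]}\subseteq R_\Box$ is an equivalence relation; (C3) for all $w$ and all $u_1,\dots,u_n\in R_\Box(w)$, $\bigcap_{i\in Ag}R_{[i]}(u_i)\neq\emptyset$; (D1) if $R_\Box wv$ and $R_{\otimes_i}wu$ then $R_{\otimes_i}vu$. Optional properties (for all $i\in Ag$): (D2) every $w$ has some $v$ with $R_{\otimes_i}wv$; (D3) $R_{\otimes_i}wv$ implies $R_\Box wv$; (D4) $R_{\otimes_i}wv$ and $R_{[i]}vu$ imply $R_{\otimes_i}wu$;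 (D5) for every $w$ there is $v$ with $R_{\otimes_i}wv$ and, for all $u$, $R_{[i]}vu$ implies $R_{\otimes_i}wu$. A $\mathsf{DS}_n\mathsf{X}$-frame is a $\mathsf{DS}_n$-frame satisfying the properties in $\mathsf{X}$; a model adds a valuation $V:Atm\to\mathcal{P}(W)$. Satisfaction: $w\Vdash p$ iff $w\in V(p)$, $w\Vdash\neg p$ iff $w\notin V(p)$, $\land,\lor$ classical; $\Box,[i],\otimes_i$ are universal and $\Diamond,\langle i\rangle,\ominus_i$ existential over $R_\Box,R_{[i]},R_{\otimes_i}$ respectively. Sequents: $\mathcal{R}\vdash\Gamma$ where $\mathcal{R}$ is a multiset of relational atoms $R_\Box xy$, $R_{[i]}xy$, $R_{\otimes_i}xy$ and $\Gamma$ a multiset of labelled formulas $x:\phi$ ($x,y$ from a countable set of labels, $\phi\in\mathcal{L}_n$). Given a model $M$ and a map $I$ from labels to worlds, $M,I\models\mathcal{R}\vdash\Gamma$ iff: if $R_\alpha I(x)I(y)$ holds in $M$ for all $R_\alpha xy\in\mathcal{R}$, then $M,I(z)\Vdash\phi$ for some $z:\phi\in\Gamma$. The sequent is valid relative to $\mathsf{DS}_n\mathsf{X}$ iff $M,I\models\Lambda$ for every $\mathsf{DS}_n\mathsf{X}$-model $M$ and every $I$. Paths: $x\sim^{\mathcal{R}}_i y$ iff $x=y$ or there is a chain $x=z_0,z_1,\dots,z_k=y$ with $R_{[i]}z_jz_{j+1}$ or $R_{[i]}z_{j+1}z_j$ in $\mathcal{R}$ for each $j$. $x\sim^{\mathcal{R}}_\Diamond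 y$ is defined likewise with links $R_\Box$ or $R_{[j]}$ (any $j\in Ag$) in either direction. Calculus $\mathsf{G3DS}_n$ (rules written premise(s) $\Rightarrow$ conclusion; "fresh" means not in the conclusion): (id) axiom $\mathcal{R}\vdash x:p,x:\neg p,\Gamma$; ($\lor$) $\mathcal{R}\vdash x:\phi,x:\psi,\Gamma\Rightarrow\mathcal{R}\vdash x:\phi\lor\psi,\Gamma$; ($\land$) $\mathcal{R}\vdash x:\phi,\Gamma$ and $\mathcal{R}\vdash x:\psi,\Gamma\Rightarrow\mathcal{R}\vdash x:\phi\land\psi,\Gamma$; ($\Box$) $\mathcal{R},R_\Box xy\vdash y:\phi,\Gamma\Rightarrow\mathcal{R}\vdash x:\Box\phi,\Gamma$, $y$ fresh; ($\Diamond$) $\mathcal{R}\vdash x:\Diamond\phi,y:\phi,\Gamma\Rightarrow\mathcal{R}\vdash x:\Diamond\phi,\Gamma$ if $x\sim^{\mathcal{R}}_\Diamond y$; ($[i]$) $\mathcal{R},R_{[i]}xy\vdash y:\phi,\Gamma\Rightarrow\mathcal{R}\vdash x:[i]\phi,\Gamma$, $y$ fresh; ($\langle i\rangle$) $\mathcal{R}\vdash x:\langle i\rangle\phi,y:\phi,\Gamma\Rightarrow\mathcal{R}\vdash x:\langle i\rangle\phi,\Gamma$ if $x\sim^{\mathcal{R}}_i y$; ($\otimes_i$) $\mathcal{R},R_{\otimes_i}xy\vdash y:\phi,\Gamma\Rightarrow\mathcal{R}\vdash x:\otimes_i\phi,\Gamma$, $y$ fresh; ($\ominus_i$) $\mathcal{R},R_{\otimes_i}xy\vdash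 x:\ominus_i\phi,y:\phi,\Gamma\Rightarrow\mathcal{R},R_{\otimes_i}xy\vdash x:\ominus_i\phi,\Gamma$; (IOA) $\mathcal{R},R_{[1]}x_1y,\dots,R_{[n]}x_ny\vdash\Gamma\Rightarrow\mathcal{R}\vdash\Gamma$, $y$ fresh and $x_j\sim^{\mathcal{R}}_\Diamond x_{j+1}$ for all $j$; (D1$_i$) $\mathcal{R},R_{\otimes_i}xz,R_{\otimes_i}yz\vdash\Gamma\Rightarrow\mathcal{R},R_{\otimes_i}xz\vdash\Gamma$ if $x\sim^{\mathcal{R}}_\Diamond y$; one copy of each agent-indexed rule for each $i\in Ag$. Extra rules: (D2$_i$) $\mathcal{R},R_{\otimes_i}xy\vdash\Gamma\Rightarrow\mathcal{R}\vdash\Gamma$, $y$ fresh; (D3$_i$) $\mathcal{R},R_{\otimes_i}xy,R_\Box xy\vdash\Gamma\Rightarrow\mathcal{R},R_{\otimes_i}xy\vdash\Gamma$; (D4$_i$) $\mathcal{R},R_{\otimes_i}xy,R_{\otimes_i}xz\vdash\Gamma\Rightarrow\mathcal{R},R_{\otimes_i}xy\vdash\Gamma$ if $y\sim^{\mathcal{R}}_i z$; (D5$_i$) is the system of two rules (D5$^1_i$) $\mathcal{R},R_{\otimes_i}xy\vdash\Gamma\Rightarrow\mathcal{R}\vdash\Gamma$ with $y$ fresh, and (D5$^2_i$) $\mathcal{R}',R_{\otimes_i}xz\vdash\Gamma'\Rightarrow\mathcal{R}'\vdash\Gamma'$ with $y\sim^{\mathcal{R}'}_i z$, where $R_{\otimes_i}xy$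 was introduced by an application of (D5$^1_i$) further down in the derivation (every use of (D5$^2_i$) requires such an application of (D5$^1_i$) below it). $\mathsf{G3DS}_n\mathsf{X}$ is $\mathsf{G3DS}_n$ plus (D$K_i$) for all $i\in Ag$ whenever $\mathbf{D}K\in\mathsf{X}$. A derivation is a finite tree of rule applications whose leaves are instances of (id). *)

theory Defs
  imports "HOL-Library.Multiset" "HOL-Library.Countable"
begin

definition Ag :: "nat \<Rightarrow> nat set" where
  "Ag n = {1..n}"

text \<open>
  Formulas are in negation normal form. \<open>Stit i\<close>, \<open>DStit i\<close>, \<open>Ought i\<close>, \<open>Perm i\<close> stand for
  \<open>[i]\<close>, \<open>\<langle>i\<rangle>\<close>, \<open>\<otimes>\<^sub>i\<close>, \<open>\<ominus>\<^sub>i\<close>. The raw datatype admits every natural number as an agent;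
  \<open>lang n\<close> is the language whose agents are those of \<open>Ag n\<close>.
\<close>

datatype 'p fm =
    Pos 'p
  | Neg 'p
  | Disj "'p fm" "'p fm"
  | Conj "'p fm" "'p fm"
  | Box "'p fm"
  | Dia "'p fm"
  | Stit nat "'p fm"
  | DStit nat "'p fm"
  | Ought nat "'p fm"
  | Perm nat "'p fm"

primrec agents_fm :: "'p fm \<Rightarrow> nat set" where
  "agents_fm (Pos p) = {}"
| "agents_fm (Neg p) = {}"
| "agents_fm (Disj \<phi> \<psi>) = agents_fm \<phi> \<union> agents_fm \<psi>"
| "agents_fm (Conj \<phi> \<psi>) = agents_fm \<phi> \<union> agents_fm \<psi>"
| "agents_fm (Box \<phi>) = agents_fm \<phi>"
| "agents_fm (Dia \<phi>) = agents_fm \<phi>"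
| "agents_fm (Stit i \<phi>) = insert i (agents_fm \<phi>)"
| "agents_fm (DStit i \<phi>) = insert i (agents_fm \<phi>)"
| "agents_fm (Ought i \<phi>) = insert i (agents_fm \<phi>)"
| "agents_fm (Perm i \<phi>) = insert i (agents_fm \<phi>)"

definition lang :: "nat \<Rightarrow> 'p fm set" where
  "lang n = {\<phi>. agents_fm \<phi> \<subseteq> Ag n}"

record 'w frame =
  worlds :: "'w set"
  rel_box :: "('w \<times> 'w) set"
  rel_stit :: "nat \<Rightarrow> ('w \<times> 'w) set"
  rel_ought :: "nat \<Rightarrow> ('w \<times> 'w) set"

record ('w, 'p) model = "'w frame" +
  val :: "'p \<Rightarrow> 'w set"

definition DS_frame :: "nat \<Rightarrow> ('w, 'm) frame_scheme \<Rightarrow> bool" where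
  "DS_frame n F \<longleftrightarrow>
     worlds F \<noteq> {} \<and>
     (\<forall>i\<in>Ag n. rel_ought F i \<subseteq> worlds F \<times> worlds F) \<and>
     equiv (worlds F) (rel_box F) \<and>
     (\<forall>i\<in>Ag n. rel_stit F i \<subseteq> rel_box F \<and> equiv (worlds F) (rel_stit F i)) \<and>
     (\<forall>w\<in>worlds F. \<forall>u. (\<forall>i\<in>Ag n. u i \<in> rel_box F `` {w}) \<longrightarrow>
               (\<Inter>i\<in>Ag n. rel_stit F i `` {u i}) \<noteq> {}) \<and>
     (\<forall>i\<in>Ag n. \<forall>w v u. (w, v) \<in> rel_box F \<and> (w, u) \<in> rel_ought F i \<longrightarrow>
               (v, u) \<in> rel_ought F i)"

datatype dprop = D2 | D3 | D4 | D5

primrec has_dprop :: "nat \<Rightarrow> ('w, 'm) frame_scheme \<Rightarrow> dprop \<Rightarrow> bool" where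
  "has_dprop n F D2 \<longleftrightarrow>
     (\<forall>i\<in>Ag n. \<forall>w\<in>worlds F. \<exists>v\<in>worlds F. (w, v) \<in> rel_ought F i)"
| "has_dprop n F D3 \<longleftrightarrow>
     (\<forall>i\<in>Ag n. \<forall>w v. (w, v) \<in> rel_ought F i \<longrightarrow> (w, v) \<in> rel_box F)"
| "has_dprop n F D4 \<longleftrightarrow>
     (\<forall>i\<in>Ag n. \<forall>w v u. (w, v) \<in> rel_ought F i \<and> (v, u) \<in> rel_stit F i \<longrightarrow>
        (w, u) \<in> rel_ought F i)"
| "has_dprop n F D5 \<longleftrightarrow>
     (\<forall>i\<in>Ag n. \<forall>w\<in>worlds F. \<exists>v\<in>worlds F. (w, v) \<in> rel_ought F i \<and>
        (\<forall>u. (v, u) \<in> rel_stit F i \<longrightarrow> (w, u) \<in> rel_ought F i))"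

definition DSX_frame :: "nat \<Rightarrow> dprop set \<Rightarrow> ('w, 'm) frame_scheme \<Rightarrow> bool" where
  "DSX_frame n X F \<longleftrightarrow> DS_frame n F \<and> (\<forall>d\<in>X. has_dprop n F d)"

definition DSX_model :: "nat \<Rightarrow> dprop set \<Rightarrow> ('w, 'p) model \<Rightarrow> bool" where
  "DSX_model n X M \<longleftrightarrow> DSX_frame n X M \<and> (\<forall>p. val M p \<subseteq> worlds M)"

primrec sat :: "('w, 'p) model \<Rightarrow> 'w \<Rightarrow> 'p fm \<Rightarrow> bool" where
  "sat M w (Pos p) \<longleftrightarrow> w \<in> val M p"
| "sat M w (Neg p) \<longleftrightarrow> w \<notin> val M p"
| "sat M w (Disj \<phi> \<psi>) \<longleftrightarrow> sat M w \<phi> \<or> sat M w \<psi>"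
| "sat M w (Conj \<phi> \<psi>) \<longleftrightarrow> sat M w \<phi> \<and> sat M w \<psi>"
| "sat M w (Box \<phi>) \<longleftrightarrow> (\<forall>v \<in> rel_box M `` {w}. sat M v \<phi>)"
| "sat M w (Dia \<phi>) \<longleftrightarrow> (\<exists>v \<in> rel_box M `` {w}. sat M v \<phi>)"
| "sat M w (Stit i \<phi>) \<longleftrightarrow> (\<forall>v \<in> rel_stit M i `` {w}. sat M v \<phi>)"
| "sat M w (DStit i \<phi>) \<longleftrightarrow> (\<exists>v \<in> rel_stit M i `` {w}. sat M v \<phi>)"
| "sat M w (Ought i \<phi>) \<longleftrightarrow> (\<forall>v \<in> rel_ought M i `` {w}. sat M v \<phi>)"
| "sat M w (Perm i \<phi>) \<longleftrightarrow> (\<exists>v \<in> rel_ought M i `` {w}. sat M v \<phi>)"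

type_synonym label = nat

datatype ratom =
    RBox label label
  | RStit nat label label
  | ROught nat label label

type_synonym 'p sequent = "ratom multiset \<times> (label \<times> 'p fm) multiset"

primrec agents_ratom :: "ratom \<Rightarrow> nat set" where
  "agents_ratom (RBox x y) = {}"
| "agents_ratom (RStit i x y) = {i}"
| "agents_ratom (ROught i x y) = {i}"

definition sequents :: "nat \<Rightarrow> 'p sequent set" where
  "sequents n = {(R, \<Gamma>). (\<forall>a \<in># R. agents_ratom a \<subseteq> Ag n) \<and> (\<forall>(x, \<phi>) \<in># \<Gamma>. \<phi> \<in> lang n)}"

primrec ratom_holds :: "('w, 'm) frame_scheme \<Rightarrow> (label \<Rightarrow> 'w) \<Rightarrow> ratom \<Rightarrow> bool" where
  "ratom_holds F I (RBox x y) \<longleftrightarrow> (I x, I y) \<in> rel_box F"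
| "ratom_holds F I (RStit i x y) \<longleftrightarrow> (I x, I y) \<in> rel_stit F i"
| "ratom_holds F I (ROught i x y) \<longleftrightarrow> (I x, I y) \<in> rel_ought F i"

definition sat_sequent :: "('w, 'p) model \<Rightarrow> (label \<Rightarrow> 'w) \<Rightarrow> 'p sequent \<Rightarrow> bool" where
  "sat_sequent M I \<Lambda> \<longleftrightarrow>
     (\<forall>a \<in># fst \<Lambda>. ratom_holds M I a) \<longrightarrow> (\<exists>(z, \<phi>) \<in># snd \<Lambda>. sat M (I z) \<phi>)"

text \<open>
  Validity over all models whose set of worlds is some nonempty subset of the type \<open>'w\<close>
  (HOL cannot quantify over all types inside a formula).
\<close>

definition valid :: "'w itself \<Rightarrow> nat \<Rightarrow> dprop set \<Rightarrow> 'p sequent \<Rightarrow> bool" where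
  "valid TYPE('w) n X \<Lambda> \<longleftrightarrow>
     (\<forall>(M :: ('w, 'p) model) I.
        DSX_model n X M \<and> range I \<subseteq> worlds M \<longrightarrow> sat_sequent M I \<Lambda>)"

definition path_stit :: "nat \<Rightarrow> ratom multiset \<Rightarrow> label \<Rightarrow> label \<Rightarrow> bool" where
  "path_stit i R = (\<lambda>x y. RStit i x y \<in># R \<or> RStit i y x \<in># R)\<^sup>*\<^sup>*"

definition path_dia :: "nat \<Rightarrow> ratom multiset \<Rightarrow> label \<Rightarrow> label \<Rightarrow> bool" where
  "path_dia n R =
     (\<lambda>x y. RBox x y \<in># R \<or> RBox y x \<in># R \<or>
        (\<exists>j\<in>Ag n. RStit j x y \<in># R \<or> RStit j y x \<in># R))\<^sup>*\<^sup>*"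

primrec labels_ratom :: "ratom \<Rightarrow> label set" where
  "labels_ratom (RBox x y) = {x, y}"
| "labels_ratom (RStit i x y) = {x, y}"
| "labels_ratom (ROught i x y) = {x, y}"

definition fresh :: "label \<Rightarrow> ratom multiset \<Rightarrow> (label \<times> 'p fm) multiset \<Rightarrow> bool" where
  "fresh y R \<Gamma> \<longleftrightarrow> y \<notin> (\<Union>a \<in> set_mset R. labels_ratom a) \<union> fst ` set_mset \<Gamma>"

text \<open>
  \<open>derives n X S R \<Gamma>\<close> says that there is a tree of rule applications with leaves \<open>id\<close> and
  end sequent \<open>R \<turnstile> \<Gamma>\<close>, to be placed above a stretch of derivation in which, on the way down to
  the root, exactly the atoms \<open>ROught i x y\<close> with \<open>(i, x, y) \<in> S\<close> are introduced by
  \<open>D5\<^sup>1\<close>. The parameter \<open>S\<close> only serves to state the non-local side condition of \<open>D5\<^sup>2\<close>: no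
  other rule inspects it, \<open>D5\<^sup>1\<close> alone extends it, and it is empty at the root.
\<close>

inductive derives ::
  "nat \<Rightarrow> dprop set \<Rightarrow> (nat \<times> label \<times> label) set \<Rightarrow>
   ratom multiset \<Rightarrow> (label \<times> 'p fm) multiset \<Rightarrow> bool"
  for n :: nat and X :: "dprop set" where
  id_rule:
    "derives n X S R (add_mset (x, Pos p) (add_mset (x, Neg p) \<Gamma>))"
| disj_rule:
    "derives n X S R (add_mset (x, \<phi>) (add_mset (x, \<psi>) \<Gamma>)) \<Longrightarrow>
     derives n X S R (add_mset (x, Disj \<phi> \<psi>) \<Gamma>)"
| conj_rule:
    "derives n X S R (add_mset (x, \<phi>) \<Gamma>) \<Longrightarrow>
     derives n X S R (add_mset (x, \<psi>) \<Gamma>) \<Longrightarrow>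
     derives n X S R (add_mset (x, Conj \<phi> \<psi>) \<Gamma>)"
| box_rule:
    "fresh y R (add_mset (x, Box \<phi>) \<Gamma>) \<Longrightarrow>
     derives n X S (add_mset (RBox x y) R) (add_mset (y, \<phi>) \<Gamma>) \<Longrightarrow>
     derives n X S R (add_mset (x, Box \<phi>) \<Gamma>)"
| dia_rule:
    "path_dia n R x y \<Longrightarrow>
     derives n X S R (add_mset (x, Dia \<phi>) (add_mset (y, \<phi>) \<Gamma>)) \<Longrightarrow>
     derives n X S R (add_mset (x, Dia \<phi>) \<Gamma>)"
| stit_rule:
    "i \<in> Ag n \<Longrightarrow>
     fresh y R (add_mset (x, Stit i \<phi>) \<Gamma>) \<Longrightarrow>
     derives n X S (add_mset (RStit i x y) R) (add_mset (y, \<phi>) \<Gamma>) \<Longrightarrow>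
     derives n X S R (add_mset (x, Stit i \<phi>) \<Gamma>)"
| dstit_rule:
    "i \<in> Ag n \<Longrightarrow>
     path_stit i R x y \<Longrightarrow>
     derives n X S R (add_mset (x, DStit i \<phi>) (add_mset (y, \<phi>) \<Gamma>)) \<Longrightarrow>
     derives n X S R (add_mset (x, DStit i \<phi>) \<Gamma>)"
| ought_rule:
    "i \<in> Ag n \<Longrightarrow>
     fresh y R (add_mset (x, Ought i \<phi>) \<Gamma>) \<Longrightarrow>
     derives n X S (add_mset (ROught i x y) R) (add_mset (y, \<phi>) \<Gamma>) \<Longrightarrow>
     derives n X S R (add_mset (x, Ought i \<phi>) \<Gamma>)"
| perm_rule:
    "i \<in> Ag n \<Longrightarrow>
     derives n X S (add_mset (ROught i x y) R) (add_mset (x, Perm i \<phi>) (add_mset (y, \<phi>) \<Gamma>)) \<Longrightarrow>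
     derives n X S (add_mset (ROught i x y) R) (add_mset (x, Perm i \<phi>) \<Gamma>)"
| IOA_rule:
    "fresh y R \<Gamma> \<Longrightarrow>
     \<forall>j\<in>{1..<n}. path_dia n R (xs j) (xs (Suc j)) \<Longrightarrow>
     derives n X S (R + {#RStit j (xs j) y. j \<in># mset_set (Ag n)#}) \<Gamma> \<Longrightarrow>
     derives n X S R \<Gamma>"
| D1_rule:
    "i \<in> Ag n \<Longrightarrow>
     path_dia n R x y \<Longrightarrow>
     derives n X S (add_mset (ROught i x z) (add_mset (ROught i y z) R)) \<Gamma> \<Longrightarrow>
     derives n X S (add_mset (ROught i x z) R) \<Gamma>"
| D2_rule:
    "D2 \<in> X \<Longrightarrow> i \<in> Ag n \<Longrightarrow>
     fresh y R \<Gamma> \<Longrightarrow>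
     derives n X S (add_mset (ROught i x y) R) \<Gamma> \<Longrightarrow>
     derives n X S R \<Gamma>"
| D3_rule:
    "D3 \<in> X \<Longrightarrow> i \<in> Ag n \<Longrightarrow>
     derives n X S (add_mset (ROught i x y) (add_mset (RBox x y) R)) \<Gamma> \<Longrightarrow>
     derives n X S (add_mset (ROught i x y) R) \<Gamma>"
| D4_rule:
    "D4 \<in> X \<Longrightarrow> i \<in> Ag n \<Longrightarrow>
     path_stit i R y z \<Longrightarrow>
     derives n X S (add_mset (ROught i x y) (add_mset (ROught i x z) R)) \<Gamma> \<Longrightarrow>
     derives n X S (add_mset (ROught i x y) R) \<Gamma>"
| D5_1_rule:
    "D5 \<in> X \<Longrightarrow> i \<in> Ag n \<Longrightarrow>
     fresh y R \<Gamma> \<Longrightarrow>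
     derives n X (insert (i, x, y) S) (add_mset (ROught i x y) R) \<Gamma> \<Longrightarrow>
     derives n X S R \<Gamma>"
| D5_2_rule:
    "D5 \<in> X \<Longrightarrow> i \<in> Ag n \<Longrightarrow>
     (i, x, y) \<in> S \<Longrightarrow>
     path_stit i R y z \<Longrightarrow>
     derives n X S (add_mset (ROught i x z) R) \<Gamma> \<Longrightarrow>
     derives n X S R \<Gamma>"

definition derivable :: "nat \<Rightarrow> dprop set \<Rightarrow> 'p sequent \<Rightarrow> bool" where
  "derivable n X \<Lambda> \<longleftrightarrow> derives n X {} (fst \<Lambda>) (snd \<Lambda>)"

end

theory Submission
  imports Defs
begin

text \<open>
  Soundness is an induction on derivations. In (D2) and (D5) the label \<open>x\<close> need not occur in the
  conclusion, so it may coincide with the fresh label \<open>y\<close> and the new atom may assert a reflexive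
  \<open>R\<^sub>\<otimes>\<close>-point. Such a point need not exist in a given model, but adding an isolated point that is
  reflexive for every relation changes neither the frame conditions nor truth at the old worlds.

  For completeness, a fair enumeration of all rule instances extends an underivable sequent to an
  increasing chain of underivable sequents. The relational atoms of the limit define a model on
  the labels in which every labelled formula that ever occurs in the chain is false.
\<close>

section \<open>Adding isolated points\<close>

text \<open>The obstacle is that the rules are used exactly as given: no structural rule is invoked,
  the rules for connectives and universal modalities drop their principal formula, and (D5) is not
  local. The non-locality is absorbed by carrying the set \<open>S\<close> along in both directions.
  In soundness an entry \<open>(i, x, y)\<close> promises that the whole \<open>[i]\<close>-cell of
  \<open>I y\<close> is ideal at \<open>I x\<close>; in completeness \<open>S\<close> is part of the
  state and never shrinks, so a (D5) witness remains available later. The limit works because every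
  side condition except freshness is monotone in \<open>R\<close> and \<open>S\<close> and depends
  on finitely many atoms: once true it stays true, so a task that returns infinitely often finally
  meets all its conditions at one stage. As paths are chains of links in either direction, the box
  and choice relations of the limit can be the generated equivalences, and labels are never
  identified.\<close>

lemma DS_frameD:
  assumes "DS_frame n F"
  shows DS_frame_nonempty: "worlds F \<noteq> {}"
    and DS_frame_ought_worlds: "i \<in> Ag n \<Longrightarrow> rel_ought F i \<subseteq> worlds F \<times> worlds F"
    and DS_frame_box_equiv: "equiv (worlds F) (rel_box F)"
    and DS_frame_stit_box: "i \<in> Ag n \<Longrightarrow> rel_stit F i \<subseteq> rel_box F"
    and DS_frame_stit_equiv: "i \<in> Ag n \<Longrightarrow> equiv (worlds F) (rel_stit F i)"
    and DS_frame_independence: "w \<in> worlds F \<Longrightarrow> (\<And>i. i \<in> Ag n \<Longrightarrow> (w, u i) \<in> rel_box F) \<Longrightarrow>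
          \<exists>v. \<forall>i\<in>Ag n. (u i, v) \<in> rel_stit F i"
    and DS_frame_ought_box: "i \<in> Ag n \<Longrightarrow> (w, v) \<in> rel_box F \<Longrightarrow> (w, z) \<in> rel_ought F i \<Longrightarrow>
          (v, z) \<in> rel_ought F i"
proof -
  note c1 = assms[unfolded DS_frame_def]
  note c2 = c1[THEN conjunct2] note c3 = c2[THEN conjunct2] note c4 = c3[THEN conjunct2]
  note c5 = c4[THEN conjunct2] note c6 = c5[THEN conjunct2]
  show "worlds F \<noteq> {}" by (rule c1[THEN conjunct1])
  show "equiv (worlds F) (rel_box F)" by (rule c3[THEN conjunct1])
  show "i \<in> Ag n \<Longrightarrow> rel_ought F i \<subseteq> worlds F \<times> worlds F"
    by (rule c2[THEN conjunct1, rule_format])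
  show "i \<in> Ag n \<Longrightarrow> rel_stit F i \<subseteq> rel_box F"
    by (rule c4[THEN conjunct1, rule_format, THEN conjunct1])
  show "i \<in> Ag n \<Longrightarrow> equiv (worlds F) (rel_stit F i)"
    by (rule c4[THEN conjunct1, rule_format, THEN conjunct2])
  show "\<exists>v. \<forall>i\<in>Ag n. (u i, v) \<in> rel_stit F i"
    if "w \<in> worlds F" "\<And>i. i \<in> Ag n \<Longrightarrow> (w, u i) \<in> rel_box F"
  proof -
    have "(\<Inter>i\<in>Ag n. rel_stit F i `` {u i}) \<noteq> {}"
      using c5[THEN conjunct1, rule_format, of w u] that by simp
    then show ?thesis by auto
  qed
  show "i \<in> Ag n \<Longrightarrow> (w, v) \<in> rel_box F \<Longrightarrow> (w, z) \<in> rel_ought F i \<Longrightarrow> (v, z) \<in> rel_ought F i"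
    using c6[rule_format, of i w v z] by simp
qed

definition extend_rel :: "('v \<Rightarrow> 'w) \<Rightarrow> 'w set \<Rightarrow> ('v \<times> 'v) set \<Rightarrow> ('w \<times> 'w) set" where
  "extend_rel f E r = map_prod f f ` r \<union> Id_on E"

text \<open>Serves two purposes: soundness takes \<open>Some\<close> and \<open>{None}\<close> to
  gain one point, completeness takes an injection and \<open>{}\<close> to move a model to another
  type.\<close>

definition extend_model :: "('v \<Rightarrow> 'w) \<Rightarrow> 'w set \<Rightarrow> ('v, 'p) model \<Rightarrow> ('w, 'p) model" where
  "extend_model f E M =
     \<lparr>worlds = f ` worlds M \<union> E,
      rel_box = extend_rel f E (rel_box M),
      rel_stit = (\<lambda>i. extend_rel f E (rel_stit M i)),
      rel_ought = (\<lambda>i. extend_rel f E (rel_ought M i)),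
      val = (\<lambda>p. f ` val M p)\<rparr>"

context
  fixes f :: "'v \<Rightarrow> 'w" and E :: "'w set"
  assumes inj: "inj f" and disj: "range f \<inter> E = {}"
begin

text \<open>No arrow leaves the image of \<open>f\<close>, so the old worlds form a generated
  submodel. Modalities only look forward along their relations, so this is what makes
  \<open>f\<close> preserve truth.\<close>

lemma extend_rel_iff:
  "(f w, v) \<in> extend_rel f E r \<longleftrightarrow> (\<exists>u. v = f u \<and> (w, u) \<in> r)"
proof
  assume "(f w, v) \<in> extend_rel f E r"
  then show "\<exists>u. v = f u \<and> (w, u) \<in> r" using inj disj by (auto simp: extend_rel_def inj_eq)
qed (auto simp: extend_rel_def)

lemma extend_rel_point_iff:
  "e \<in> E \<Longrightarrow> (e, v) \<in> extend_rel f E r \<longleftrightarrow> v = e"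
  using disj by (auto simp: extend_rel_def)

lemma extend_rel_cases:
  assumes "(w, v) \<in> extend_rel f E r"
  obtains (point) "w \<in> E" "v = w" | (image) a b where "w = f a" "v = f b" "(a, b) \<in> r"
  using assms by (auto simp: extend_rel_def)

lemma equiv_extend_rel:
  assumes "equiv A r"
  shows "equiv (f ` A \<union> E) (extend_rel f E r)"
proof (rule equivI)
  from assms have r: "r \<subseteq> A \<times> A" "\<And>x. x \<in> A \<Longrightarrow> (x, x) \<in> r" "sym r" "trans r"
    by (auto simp: equiv_def refl_on_def)
  show "extend_rel f E r \<subseteq> (f ` A \<union> E) \<times> (f ` A \<union> E)"
    using r(1) by (auto simp: extend_rel_def)
  show "refl_on (f ` A \<union> E) (extend_rel f E r)"
    using r(2) by (force simp: refl_on_def extend_rel_def)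
  show "sym (extend_rel f E r)"
    using r(3) by (force simp: sym_def extend_rel_def)
  show "trans (extend_rel f E r)"
  proof (rule transI)
    fix x y z
    assume "(x, y) \<in> extend_rel f E r" "(y, z) \<in> extend_rel f E r"
    with r(4) show "(x, z) \<in> extend_rel f E r"
      by (elim extend_rel_cases[of x]) (auto simp: extend_rel_iff extend_rel_point_iff dest: transD)
  qed
qed

lemma sat_extend_model: "sat (extend_model f E M) (f w) \<phi> \<longleftrightarrow> sat M w \<phi>"
proof (induction \<phi> arbitrary: w)
  case (Pos p)
  then show ?case using inj by (simp add: extend_model_def inj_image_mem_iff)
next
  case (Neg p)
  then show ?case using inj by (simp add: extend_model_def inj_image_mem_iff)
qed (auto simp: extend_model_def Image_singleton extend_rel_iff)

text \<open>No relation links the old model with a new point or two new points with each other, so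
  each condition can be checked within one component: by hypothesis on the image, trivially on a
  single reflexive point.\<close>

lemma DSX_model_extend_model:
  assumes M: "DSX_model n X M"
  shows "DSX_model n X (extend_model f E M)"
proof -
  let ?N = "extend_model f E M"
  let ?ext = "extend_rel f E"
  have sel: "worlds ?N = f ` worlds M \<union> E" "rel_box ?N = ?ext (rel_box M)"
    "rel_stit ?N = (\<lambda>i. ?ext (rel_stit M i))" "rel_ought ?N = (\<lambda>i. ?ext (rel_ought M i))"
    "val ?N = (\<lambda>p. f ` val M p)"
    by (simp_all add: extend_model_def)
  from M have DS: "DS_frame n M" and D: "\<And>d. d \<in> X \<Longrightarrow> has_dprop n M d"
    and V: "\<And>p. val M p \<subseteq> worlds M"
    by (auto simp: DSX_model_def DSX_frame_def)
  note D1 = DS_frame_ought_box[OF DS] note C3 = DS_frame_independence[OF DS]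
  have "DS_frame n ?N"
    unfolding DS_frame_def
  proof (intro conjI ballI allI impI)
    show "worlds ?N \<noteq> {}" using DS_frame_nonempty[OF DS] by (simp add: sel)
    show "equiv (worlds ?N) (rel_box ?N)" unfolding sel
      by (rule equiv_extend_rel[OF DS_frame_box_equiv[OF DS]])
  next
    fix i assume i: "i \<in> Ag n"
    show "rel_ought ?N i \<subseteq> worlds ?N \<times> worlds ?N"
      using DS_frame_ought_worlds[OF DS i] by (auto simp: sel extend_rel_def)
    show "rel_stit ?N i \<subseteq> rel_box ?N" using DS_frame_stit_box[OF DS i] by (auto simp: sel extend_rel_def)
    show "equiv (worlds ?N) (rel_stit ?N i)" unfolding sel
      by (rule equiv_extend_rel[OF DS_frame_stit_equiv[OF DS i]])
  next
    fix w u assume w: "w \<in> worlds ?N" and u: "\<forall>i\<in>Ag n. u i \<in> rel_box ?N `` {w}"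
    show "(\<Inter>i\<in>Ag n. rel_stit ?N i `` {u i}) \<noteq> {}"
    \<comment> \<open>Box successors stay in the component of \<open>w\<close>: the
      \<open>u i\<close> all equal \<open>w\<close>, or they are images of worlds to which (C3) in
      \<open>M\<close> applies.\<close>
    proof (cases "w \<in> E")
      case True
      with u have "\<And>i. i \<in> Ag n \<Longrightarrow> u i = w"
        by (simp add: sel extend_rel_point_iff)
      with True have "w \<in> (\<Inter>i\<in>Ag n. rel_stit ?N i `` {u i})"
        by (auto simp: sel extend_rel_point_iff)
      then show ?thesis by blast
    next
      case False
      with w obtain a where a: "w = f a" "a \<in> worlds M" by (auto simp: sel)
      with u have "\<forall>i\<in>Ag n. \<exists>b. u i = f b \<and> (a, b) \<in> rel_box M"
        by (simp add: sel extend_rel_iff)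
      then obtain b where b: "\<And>i. i \<in> Ag n \<Longrightarrow> u i = f (b i)" "\<And>i. i \<in> Ag n \<Longrightarrow> (a, b i) \<in> rel_box M"
        by metis
      from C3[OF a(2), of b] b(2) obtain c where "\<forall>i\<in>Ag n. (b i, c) \<in> rel_stit M i" by blast
      then have "f c \<in> (\<Inter>i\<in>Ag n. rel_stit ?N i `` {u i})"
        using b(1) by (auto simp: sel extend_rel_iff)
      then show ?thesis by blast
    qed
  next
    fix i w v u
    assume i: "i \<in> Ag n" and *: "(w, v) \<in> rel_box ?N \<and> (w, u) \<in> rel_ought ?N i"
    with D1[OF i] show "(v, u) \<in> rel_ought ?N i"
      unfolding sel
      by (elim conjE extend_rel_cases[of w v]) (auto simp: extend_rel_iff extend_rel_point_iff)
  qed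
  moreover have "has_dprop n ?N d" if "d \<in> X" for d
  proof (cases d)
    case D2
    with D[OF that] have "\<And>i a. i \<in> Ag n \<Longrightarrow> a \<in> worlds M \<Longrightarrow> \<exists>b\<in>worlds M. (a, b) \<in> rel_ought M i"
      by auto
    then have "\<exists>v\<in>f ` worlds M \<union> E. (w, v) \<in> ?ext (rel_ought M i)"
      if "i \<in> Ag n" "w \<in> f ` worlds M \<union> E" for i w
      using that by (fastforce simp: extend_rel_iff extend_rel_point_iff)
    then show ?thesis unfolding D2 has_dprop.simps sel by blast
  next
    case D3
    with D[OF that] have D3': "\<And>i w v. i \<in> Ag n \<Longrightarrow> (w, v) \<in> rel_ought M i \<Longrightarrow> (w, v) \<in> rel_box M"
      by auto
    have "(w, v) \<in> ?ext (rel_box M)" if "i \<in> Ag n" "(w, v) \<in> ?ext (rel_ought M i)" for i w v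
      using that(2) D3'[OF that(1)]
      by (elim extend_rel_cases) (auto simp: extend_rel_iff extend_rel_point_iff)
    then show ?thesis unfolding D3 has_dprop.simps sel by blast
  next
    case D4
    with D[OF that] have D4': "\<And>i w v u. i \<in> Ag n \<Longrightarrow> (w, v) \<in> rel_ought M i \<Longrightarrow>
      (v, u) \<in> rel_stit M i \<Longrightarrow> (w, u) \<in> rel_ought M i" by auto
    have "(w, u) \<in> ?ext (rel_ought M i)"
      if "i \<in> Ag n" "(w, v) \<in> ?ext (rel_ought M i)" "(v, u) \<in> ?ext (rel_stit M i)" for i w v u
      using that(2,3) D4'[OF that(1)]
      by (elim extend_rel_cases[of w v]) (auto simp: extend_rel_iff extend_rel_point_iff)
    then show ?thesis unfolding D4 has_dprop.simps sel by blast
  next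
    case D5
    show ?thesis
      unfolding D5 has_dprop.simps
    proof (intro ballI)
      fix i w assume i: "i \<in> Ag n" and w: "w \<in> worlds ?N"
      show "\<exists>v\<in>worlds ?N. (w, v) \<in> rel_ought ?N i \<and>
              (\<forall>u. (v, u) \<in> rel_stit ?N i \<longrightarrow> (w, u) \<in> rel_ought ?N i)"
      proof (cases "w \<in> E")
        case True
        then show ?thesis
          by (intro bexI[of _ w]) (simp_all add: sel extend_rel_point_iff)
      next
        case False
        with w obtain a where a: "w = f a" "a \<in> worlds M" by (auto simp: sel)
        from D[OF that] a(2) i D5 obtain b where "b \<in> worlds M" "(a, b) \<in> rel_ought M i"
          "\<And>u. (b, u) \<in> rel_stit M i \<Longrightarrow> (a, u) \<in> rel_ought M i" by (simp, blast)
        then show ?thesis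
          by (intro bexI[of _ "f b"]) (auto simp: sel a(1) extend_rel_iff)
      qed
    qed
  qed
  moreover have "val ?N p \<subseteq> worlds ?N" for p using V by (auto simp: sel)
  ultimately show ?thesis by (simp add: DSX_model_def DSX_frame_def)
qed

end

section \<open>Soundness\<close>

lemma ratom_holds_fun_upd:
  "y \<notin> labels_ratom a \<Longrightarrow> ratom_holds F (I(y := v)) a \<longleftrightarrow> ratom_holds F I a"
  by (cases a) auto

text \<open>More than falsification of the sequent: for a recorded triple, \<open>I y\<close> must
  be a genuine (D5) witness, which is what the second (D5) rule consumes. Requiring the atom to be
  in \<open>R\<close> makes freshness for \<open>R\<close> protect the labels of \<open>S\<close> as
  well.\<close>

definition refutes ::
  "('w, 'p) model \<Rightarrow> (nat \<times> label \<times> label) set \<Rightarrow> ratom multiset \<Rightarrow> (label \<times> 'p fm) multiset \<Rightarrow>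
   (label \<Rightarrow> 'w) \<Rightarrow> bool"
where
  "refutes M S R \<Gamma> I \<longleftrightarrow>
     range I \<subseteq> worlds M \<and>
     (\<forall>a\<in>#R. ratom_holds M I a) \<and>
     (\<forall>(i, x, y)\<in>S. ROught i x y \<in># R \<and>
        (\<forall>u. (I y, u) \<in> rel_stit M i \<longrightarrow> (I x, u) \<in> rel_ought M i)) \<and>
     (\<forall>(z, \<phi>)\<in>#\<Gamma>. \<not> sat M (I z) \<phi>)"

context
  fixes n :: nat and X :: "dprop set" and M :: "('w, 'p) model" and e :: 'w
  assumes n: "n \<ge> 1" and M: "DSX_model n X M" and e: "e \<in> worlds M"
    and e_ought: "\<And>i. (e, e) \<in> rel_ought M i"
    and e_stit: "\<And>i u. (e, u) \<in> rel_stit M i \<Longrightarrow> u = e"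
begin

lemma DS: "DS_frame n M" and dprop: "d \<in> X \<Longrightarrow> has_dprop n M d"
  using M by (auto simp: DSX_model_def DSX_frame_def)

lemmas box_equiv = DS_frame_box_equiv[OF DS]
  and stit_box = DS_frame_stit_box[OF DS]
  and stit_equiv = DS_frame_stit_equiv[OF DS]
  and ought_worlds = DS_frame_ought_worlds[OF DS]
  and independence = DS_frame_independence[OF DS]
  and ought_box = DS_frame_ought_box[OF DS]

lemma box_worlds: "(w, v) \<in> rel_box M \<Longrightarrow> w \<in> worlds M \<and> v \<in> worlds M"
  using box_equiv by (auto simp: equiv_def refl_on_def)

lemma stit_worlds: "i \<in> Ag n \<Longrightarrow> (w, v) \<in> rel_stit M i \<Longrightarrow> w \<in> worlds M \<and> v \<in> worlds M"
  using stit_box box_worlds by blast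

text \<open>Each link is a box pair by (C2) and symmetry, and transitivity composes them. The empty
  chain needs \<open>I x\<close> to be a world even when \<open>x\<close> does not occur in
  \<open>R\<close>, whence the condition on \<open>range I\<close>.\<close>

lemma path_dia_sound:
  assumes "path_dia n R x y" "\<forall>a\<in>#R. ratom_holds M I a" "range I \<subseteq> worlds M"
  shows "(I x, I y) \<in> rel_box M"
  using assms(1) unfolding path_dia_def
proof (induction rule: rtranclp_induct)
  case base
  then show ?case using box_equiv assms(3) by (auto simp: equiv_def refl_on_def)
next
  case (step y z)
  then have "(I y, I z) \<in> rel_box M \<or> (I z, I y) \<in> rel_box M"
    using assms(2) stit_box by fastforce
  with step.IH box_equiv show ?case by (meson equiv_def symD transD)
qed

lemma path_stit_sound:
  assumes "path_stit i R x y" "i \<in> Ag n" "\<forall>a\<in>#R. ratom_holds M I a" "range I \<subseteq> worlds M"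
  shows "(I x, I y) \<in> rel_stit M i"
  using assms(1) unfolding path_stit_def
proof (induction rule: rtranclp_induct)
  case base
  then show ?case using stit_equiv[OF assms(2)] assms(4) by (auto simp: equiv_def refl_on_def)
next
  case (step y z)
  then have "(I y, I z) \<in> rel_stit M i \<or> (I z, I y) \<in> rel_stit M i"
    using assms(3) by fastforce
  with step.IH stit_equiv[OF assms(2)] show ?case by (meson equiv_def symD transD)
qed

lemma refutes_fun_upd:
  assumes "refutes M S R \<Gamma> I" "fresh y R \<Gamma>" "v \<in> worlds M"
  shows "refutes M S R \<Gamma> (I(y := v))"
proof -
  have R: "\<And>a. a \<in># R \<Longrightarrow> y \<notin> labels_ratom a" and G: "\<And>z \<phi>. (z, \<phi>) \<in># \<Gamma> \<Longrightarrow> z \<noteq> y"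
    using assms(2) by (force simp: fresh_def)+
  \<comment> \<open>Freshness says nothing about \<open>S\<close> directly; its labels avoid
    \<open>y\<close> because its atoms lie in \<open>R\<close>.\<close>
  have S: "x \<noteq> y \<and> z \<noteq> y" if "(i, x, z) \<in> S" for i x z
  proof -
    have "ROught i x z \<in># R" using that assms(1) by (auto simp: refutes_def)
    from R[OF this] show ?thesis by auto
  qed
  show ?thesis
    unfolding refutes_def
  proof (intro conjI)
    show "range (I(y := v)) \<subseteq> worlds M" using assms(1,3) by (auto simp: refutes_def)
    show "\<forall>a\<in>#R. ratom_holds M (I(y := v)) a"
      using assms(1) R by (simp add: refutes_def ratom_holds_fun_upd)
    show "\<forall>(i, x, z)\<in>S. ROught i x z \<in># R \<and>
       (\<forall>u. ((I(y := v)) z, u) \<in> rel_stit M i \<longrightarrow> ((I(y := v)) x, u) \<in> rel_ought M i)"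
      using assms(1) S by (auto simp: refutes_def)
    show "\<forall>(z, \<phi>)\<in>#\<Gamma>. \<not> sat M ((I(y := v)) z) \<phi>"
      using assms(1) G by (auto simp: refutes_def)
  qed
qed

text \<open>Read contrapositively: a refutation of a conclusion yields one of some premise.
  \<open>I\<close> is arbitrary in the induction because rules with a fresh label change its value
  there.\<close>

lemma derives_not_refutes: "derives n X S R \<Gamma> \<Longrightarrow> \<not> refutes M S R \<Gamma> I"
proof (induction arbitrary: I rule: derives.induct)
  case (id_rule S R x p \<Gamma>)
  then show ?case by (auto simp: refutes_def)
next
  case (disj_rule S R x \<phi> \<psi> \<Gamma>)
  from disj_rule.IH[of I] show ?case by (auto simp: refutes_def)
next
  case (conj_rule S R x \<phi> \<Gamma> \<psi>)
  from conj_rule.IH(1,2)[of I] show ?case by (auto simp: refutes_def)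
next
  case (box_rule y R x \<phi> \<Gamma> S)
  show ?case
  proof
    assume *: "refutes M S R (add_mset (x, Box \<phi>) \<Gamma>) I"
    then obtain v where v: "(I x, v) \<in> rel_box M" "\<not> sat M v \<phi>" by (auto simp: refutes_def)
    have "x \<noteq> y" using box_rule.hyps(1) by (auto simp: fresh_def)
    with refutes_fun_upd[OF * box_rule.hyps(1), of v] v box_worlds[OF v(1)]
    have "refutes M S (add_mset (RBox x y) R) (add_mset (y, \<phi>) \<Gamma>) (I(y := v))"
      by (auto simp: refutes_def)
    with box_rule.IH show False by blast
  qed
next
  case (dia_rule R x y S \<phi> \<Gamma>)
  show ?case
  proof
    assume *: "refutes M S R (add_mset (x, Dia \<phi>) \<Gamma>) I"
    with path_dia_sound[OF dia_rule.hyps(1), of I]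
    have "refutes M S R (add_mset (x, Dia \<phi>) (add_mset (y, \<phi>) \<Gamma>)) I" by (auto simp: refutes_def)
    with dia_rule.IH show False by blast
  qed
next
  case (stit_rule i y R x \<phi> \<Gamma> S)
  show ?case
  proof
    assume *: "refutes M S R (add_mset (x, Stit i \<phi>) \<Gamma>) I"
    then obtain v where v: "(I x, v) \<in> rel_stit M i" "\<not> sat M v \<phi>" by (auto simp: refutes_def)
    have "x \<noteq> y" using stit_rule.hyps(2) by (auto simp: fresh_def)
    with refutes_fun_upd[OF * stit_rule.hyps(2), of v] v stit_worlds[OF stit_rule.hyps(1) v(1)]
    have "refutes M S (add_mset (RStit i x y) R) (add_mset (y, \<phi>) \<Gamma>) (I(y := v))"
      by (auto simp: refutes_def)
    with stit_rule.IH show False by blast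
  qed
next
  case (dstit_rule i R x y S \<phi> \<Gamma>)
  show ?case
  proof
    assume *: "refutes M S R (add_mset (x, DStit i \<phi>) \<Gamma>) I"
    with path_stit_sound[OF dstit_rule.hyps(2,1), of I]
    have "refutes M S R (add_mset (x, DStit i \<phi>) (add_mset (y, \<phi>) \<Gamma>)) I" by (auto simp: refutes_def)
    with dstit_rule.IH show False by blast
  qed
next
  case (ought_rule i y R x \<phi> \<Gamma> S)
  show ?case
  proof
    assume *: "refutes M S R (add_mset (x, Ought i \<phi>) \<Gamma>) I"
    then obtain v where v: "(I x, v) \<in> rel_ought M i" "\<not> sat M v \<phi>" by (auto simp: refutes_def)
    have "x \<noteq> y" using ought_rule.hyps(2) by (auto simp: fresh_def)
    moreover have "v \<in> worlds M" using v(1) ought_worlds[OF ought_rule.hyps(1)] by blast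
    ultimately have "refutes M S (add_mset (ROught i x y) R) (add_mset (y, \<phi>) \<Gamma>) (I(y := v))"
      using refutes_fun_upd[OF * ought_rule.hyps(2), of v] v by (auto simp: refutes_def)
    with ought_rule.IH show False by blast
  qed
next
  case (perm_rule i S x y R \<phi> \<Gamma>)
  from perm_rule.IH[of I] show ?case by (auto simp: refutes_def)
next
  case (IOA_rule y R \<Gamma> xs S)
  show ?case
  proof
    assume *: "refutes M S R \<Gamma> I"
    then have I: "range I \<subseteq> worlds M" "\<forall>a\<in>#R. ratom_holds M I a" by (auto simp: refutes_def)
    \<comment> \<open>The rule links only neighbouring sources; composing the links puts all of them
      in the box class of \<open>I (xs 1)\<close>, where (C3) applies.\<close>
    have path: "path_dia n R (xs 1) (xs j)" if "1 \<le> j" "j \<le> n" for j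
      using that
    proof (induction j rule: dec_induct)
      case base
      then show ?case by (simp add: path_dia_def)
    next
      case (step j)
      then have "path_dia n R (xs 1) (xs j)" "path_dia n R (xs j) (xs (Suc j))"
        using IOA_rule.hyps(2) by auto
      then show ?case unfolding path_dia_def by (rule rtranclp_trans)
    qed
    have "(I (xs 1), I (xs j)) \<in> rel_box M" if "j \<in> Ag n" for j
      using that path path_dia_sound[OF _ I(2,1)] by (auto simp: Ag_def)
    with independence[of "I (xs 1)" "\<lambda>j. I (xs j)"] I(1)
    obtain v where v: "\<And>j. j \<in> Ag n \<Longrightarrow> (I (xs j), v) \<in> rel_stit M j" by blast
    \<comment> \<open>(C3) yields an element of the type; agent 1 exists, and its choice relation
      places that element among the worlds.\<close>
    have vw: "v \<in> worlds M" using stit_worlds v[of 1] n by (force simp: Ag_def)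
    \<comment> \<open>A source \<open>xs j\<close> may be the fresh label itself, since the empty
      path does not require it to occur in \<open>R\<close>. Its new atom then becomes a loop at
      \<open>v\<close>.\<close>
    then have "\<And>j. j \<in> Ag n \<Longrightarrow> (v, v) \<in> rel_stit M j"
      using stit_equiv by (auto simp: equiv_def refl_on_def)
    with v have "ratom_holds M (I(y := v)) (RStit j (xs j) y)" if "j \<in> Ag n" for j
      using that by auto
    then have "refutes M S (R + {#RStit j (xs j) y. j \<in># mset_set (Ag n)#}) \<Gamma> (I(y := v))"
      using refutes_fun_upd[OF * IOA_rule.hyps(1) vw]
      by (auto simp: refutes_def Ag_def simp del: fun_upd_apply ratom_holds.simps)
    with IOA_rule.IH show False by blast
  qed
next
  case (D1_rule i R x y S z \<Gamma>)
  show ?case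
  proof
    assume *: "refutes M S (add_mset (ROught i x z) R) \<Gamma> I"
    then have "(I x, I y) \<in> rel_box M" using path_dia_sound[OF D1_rule.hyps(2), of I]
      by (auto simp: refutes_def)
    with * ought_box[OF D1_rule.hyps(1)]
    have "refutes M S (add_mset (ROught i x z) (add_mset (ROught i y z) R)) \<Gamma> I"
      by (auto simp: refutes_def)
    with D1_rule.IH show False by blast
  qed
next
  case (D2_rule i y R \<Gamma> S x)
  show ?case
  proof
    assume *: "refutes M S R \<Gamma> I"
    have "\<exists>v\<in>worlds M. ((I(y := v)) x, v) \<in> rel_ought M i"
    proof (cases "x = y")
      case True
      then show ?thesis using e e_ought by auto
    next
      case False
      have "I x \<in> worlds M" using * by (auto simp: refutes_def)
      with False dprop[OF D2_rule.hyps(1)] D2_rule.hyps(2) show ?thesis by auto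
    qed
    then obtain v where "v \<in> worlds M" "((I(y := v)) x, v) \<in> rel_ought M i" by blast
    with refutes_fun_upd[OF * D2_rule.hyps(3), of v]
    have "refutes M S (add_mset (ROught i x y) R) \<Gamma> (I(y := v))" by (auto simp: refutes_def)
    with D2_rule.IH show False by blast
  qed
next
  case (D3_rule i S x y R \<Gamma>)
  from D3_rule.IH[of I] dprop[OF D3_rule.hyps(1)] D3_rule.hyps(2) show ?case
    by (auto simp: refutes_def)
next
  case (D4_rule i R y z S x \<Gamma>)
  show ?case
  proof
    assume *: "refutes M S (add_mset (ROught i x y) R) \<Gamma> I"
    then have "(I y, I z) \<in> rel_stit M i" using path_stit_sound[OF D4_rule.hyps(3,2), of I]
      by (auto simp: refutes_def)
    with * dprop[OF D4_rule.hyps(1)] D4_rule.hyps(2)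
    have "(I x, I z) \<in> rel_ought M i" by (auto simp: refutes_def)
    with * have "refutes M S (add_mset (ROught i x y) (add_mset (ROught i x z) R)) \<Gamma> I"
      by (auto simp: refutes_def)
    with D4_rule.IH show False by blast
  qed
next
  case (D5_1_rule i y R \<Gamma> x S)
  show ?case
  proof
    assume *: "refutes M S R \<Gamma> I"
    have "\<exists>v\<in>worlds M. ((I(y := v)) x, v) \<in> rel_ought M i \<and>
            (\<forall>u. (v, u) \<in> rel_stit M i \<longrightarrow> ((I(y := v)) x, u) \<in> rel_ought M i)"
    proof (cases "x = y")
      case True
      \<comment> \<open>The choice cell of \<open>e\<close> is just \<open>e\<close>, so the (D5)
        condition at \<open>e\<close> reduces to its loop.\<close>
      then show ?thesis using e e_ought e_stit by (intro bexI[of _ e]) auto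
    next
      case False
      have "I x \<in> worlds M" using * by (auto simp: refutes_def)
      with False dprop[OF D5_1_rule.hyps(1)] D5_1_rule.hyps(2) show ?thesis by auto
    qed
    then obtain v where "v \<in> worlds M" "((I(y := v)) x, v) \<in> rel_ought M i"
      "\<And>u. (v, u) \<in> rel_stit M i \<Longrightarrow> ((I(y := v)) x, u) \<in> rel_ought M i" by blast
    with refutes_fun_upd[OF * D5_1_rule.hyps(3), of v]
    have "refutes M (insert (i, x, y) S) (add_mset (ROught i x y) R) \<Gamma> (I(y := v))"
      unfolding refutes_def by (simp del: fun_upd_apply add: fun_upd_same) blast
    with D5_1_rule.IH show False by blast
  qed
next
  case (D5_2_rule i x y S R z \<Gamma>)
  show ?case
  proof
    assume *: "refutes M S R \<Gamma> I"
    then have "(I y, I z) \<in> rel_stit M i" using path_stit_sound[OF D5_2_rule.hyps(4,2), of I]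
      by (auto simp: refutes_def)
    with * D5_2_rule.hyps(3) have "(I x, I z) \<in> rel_ought M i" by (auto simp: refutes_def)
    with * have "refutes M S (add_mset (ROught i x z) R) \<Gamma> I"
      by (auto simp: refutes_def)
    with D5_2_rule.IH show False by blast
  qed
qed

end

text \<open>The worlds of \<open>M\<close> may exhaust \<open>'w\<close> and leave no room for
  another point, so the induction is applied to a model over \<open>'w option\<close>.\<close>

theorem derivable_imp_valid:
  fixes \<Lambda> :: "'p sequent"
  assumes n: "n \<ge> 1" and "derivable n X \<Lambda>"
  shows "valid TYPE('w) n X \<Lambda>"
  unfolding valid_def
proof (intro allI impI)
  fix M :: "('w, 'p) model" and I :: "label \<Rightarrow> 'w"
  assume M: "DSX_model n X M \<and> range I \<subseteq> worlds M"
  let ?N = "extend_model Some {None} M"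
  have f: "inj Some" "range Some \<inter> {None} = {}" by auto
  have N: "DSX_model n X ?N" using DSX_model_extend_model[OF f] M by blast
  have e: "None \<in> worlds ?N" "\<And>i. (None, None) \<in> rel_ought ?N i"
    "\<And>i u. (None, u) \<in> rel_stit ?N i \<Longrightarrow> u = None"
    by (auto simp: extend_model_def extend_rel_def)
  have "\<not> refutes ?N {} (fst \<Lambda>) (snd \<Lambda>) (Some \<circ> I)"
    using derives_not_refutes[OF n N e] assms(2) by (auto simp: derivable_def)
  moreover have "ratom_holds ?N (Some \<circ> I) a" if "ratom_holds M I a" for a
    using that by (cases a) (auto simp: extend_model_def extend_rel_def)
  moreover have "range (Some \<circ> I) \<subseteq> worlds ?N" using M by (auto simp: extend_model_def)
  ultimately show "sat_sequent M I \<Lambda>"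
    by (auto simp: sat_sequent_def refutes_def sat_extend_model[OF f])
qed

section \<open>Completeness\<close>

subsection \<open>Tasks\<close>

text \<open>
  In \<open>Reduce x \<phi> y\<close> the label \<open>y\<close> is the target of an existential modality and is otherwise
  irrelevant. In \<open>Join xs\<close> agents index into the list, so \<open>xs ! 0\<close> is a dummy.
\<close>

datatype 'p task =
    Reduce label "'p fm" label
  | Join "label list"
  | Apply_D1 nat label label label
  | Apply_D2 nat label
  | Apply_D3 nat label label
  | Apply_D4 nat label label label
  | Apply_D5_1 nat label
  | Apply_D5_2 nat label label label

text \<open>Countability permits a fair enumeration of tasks. It is the reason for a finite list in
  \<open>Join\<close>, where the rule has a function on all natural numbers.\<close>

instance fm :: (countable) countable by countable_datatype
instance task :: (countable) countable by countable_datatype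

type_synonym 'p state =
  "(nat \<times> label \<times> label) set \<times> ratom multiset \<times> (label \<times> 'p fm) multiset"

text \<open>Unprimed arguments are the state before a step, primed ones the state after it: the
  guards of existential modalities are tested before, the results are sought after.\<close>

primrec reduced ::
  "nat \<Rightarrow> ratom multiset \<Rightarrow> ratom multiset \<Rightarrow> (label \<times> 'p fm) multiset \<Rightarrow> label \<Rightarrow> label \<Rightarrow> 'p fm \<Rightarrow> bool"
where
  "reduced n R R' \<Gamma>' x y (Pos p) \<longleftrightarrow> True"
| "reduced n R R' \<Gamma>' x y (Neg p) \<longleftrightarrow> True"
| "reduced n R R' \<Gamma>' x y (Disj \<phi> \<psi>) \<longleftrightarrow> (x, \<phi>) \<in># \<Gamma>' \<and> (x, \<psi>) \<in># \<Gamma>'"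
| "reduced n R R' \<Gamma>' x y (Conj \<phi> \<psi>) \<longleftrightarrow> (x, \<phi>) \<in># \<Gamma>' \<or> (x, \<psi>) \<in># \<Gamma>'"
| "reduced n R R' \<Gamma>' x y (Box \<phi>) \<longleftrightarrow> (\<exists>z. RBox x z \<in># R' \<and> (z, \<phi>) \<in># \<Gamma>')"
| "reduced n R R' \<Gamma>' x y (Dia \<phi>) \<longleftrightarrow> (path_dia n R x y \<longrightarrow> (y, \<phi>) \<in># \<Gamma>')"
| "reduced n R R' \<Gamma>' x y (Stit i \<phi>) \<longleftrightarrow>
     (i \<in> Ag n \<longrightarrow> (\<exists>z. RStit i x z \<in># R' \<and> (z, \<phi>) \<in># \<Gamma>'))"
| "reduced n R R' \<Gamma>' x y (DStit i \<phi>) \<longleftrightarrow> (i \<in> Ag n \<and> path_stit i R x y \<longrightarrow> (y, \<phi>) \<in># \<Gamma>')"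
| "reduced n R R' \<Gamma>' x y (Ought i \<phi>) \<longleftrightarrow>
     (i \<in> Ag n \<longrightarrow> (\<exists>z. ROught i x z \<in># R' \<and> (z, \<phi>) \<in># \<Gamma>'))"
| "reduced n R R' \<Gamma>' x y (Perm i \<phi>) \<longleftrightarrow> (i \<in> Ag n \<and> ROught i x y \<in># R \<longrightarrow> (y, \<phi>) \<in># \<Gamma>')"

text \<open>
  The formulas that their rule removes from the sequent. Such a formula stays until it is reduced,
  which is all that the limit construction needs; hence contraction is not required.
\<close>

primrec consumable :: "'p fm \<Rightarrow> bool" where
  "consumable (Pos p) = False"
| "consumable (Neg p) = False"
| "consumable (Disj \<phi> \<psi>) = True"
| "consumable (Conj \<phi> \<psi>) = True"
| "consumable (Box \<phi>) = True"
| "consumable (Dia \<phi>) = False"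
| "consumable (Stit i \<phi>) = True"
| "consumable (DStit i \<phi>) = False"
| "consumable (Ought i \<phi>) = True"
| "consumable (Perm i \<phi>) = False"

primrec fulfilled :: "nat \<Rightarrow> dprop set \<Rightarrow> 'p task \<Rightarrow> 'p state \<Rightarrow> 'p state \<Rightarrow> bool" where
  "fulfilled n X (Reduce x \<phi> y) = (\<lambda>(S, R, \<Gamma>) (S', R', \<Gamma>').
     (x, \<phi>) \<in># \<Gamma> \<longrightarrow> reduced n R R' \<Gamma>' x y \<phi>)"
| "fulfilled n X (Join xs) = (\<lambda>(S, R, \<Gamma>) (S', R', \<Gamma>').
     (\<forall>j\<in>{1..<n}. path_dia n R (xs ! j) (xs ! Suc j)) \<longrightarrow>
     (\<exists>y. \<forall>j\<in>Ag n. RStit j (xs ! j) y \<in># R'))"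
| "fulfilled n X (Apply_D1 i x y z) = (\<lambda>(S, R, \<Gamma>) (S', R', \<Gamma>').
     i \<in> Ag n \<and> path_dia n R x y \<and> ROught i x z \<in># R \<longrightarrow> ROught i y z \<in># R')"
| "fulfilled n X (Apply_D2 i x) = (\<lambda>(S, R, \<Gamma>) (S', R', \<Gamma>').
     D2 \<in> X \<and> i \<in> Ag n \<longrightarrow> (\<exists>y. ROught i x y \<in># R'))"
| "fulfilled n X (Apply_D3 i x y) = (\<lambda>(S, R, \<Gamma>) (S', R', \<Gamma>').
     D3 \<in> X \<and> i \<in> Ag n \<and> ROught i x y \<in># R \<longrightarrow> RBox x y \<in># R')"
| "fulfilled n X (Apply_D4 i x y z) = (\<lambda>(S, R, \<Gamma>) (S', R', \<Gamma>').
     D4 \<in> X \<and> i \<in> Ag n \<and> ROught i x y \<in># R \<and> path_stit i R y z \<longrightarrow> ROught i x z \<in># R')"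
| "fulfilled n X (Apply_D5_1 i x) = (\<lambda>(S, R, \<Gamma>) (S', R', \<Gamma>').
     D5 \<in> X \<and> i \<in> Ag n \<longrightarrow> (\<exists>y. (i, x, y) \<in> S' \<and> ROught i x y \<in># R'))"
| "fulfilled n X (Apply_D5_2 i x y z) = (\<lambda>(S, R, \<Gamma>) (S', R', \<Gamma>').
     D5 \<in> X \<and> i \<in> Ag n \<and> (i, x, y) \<in> S \<and> path_stit i R y z \<longrightarrow> ROught i x z \<in># R')"

text \<open>The clause on formulas allows a formula to vanish only in a \<open>Reduce\<close> step
  on that very formula, so none is lost without having been reduced.\<close>

definition step :: "nat \<Rightarrow> dprop set \<Rightarrow> 'p task \<Rightarrow> 'p state \<Rightarrow> 'p state \<Rightarrow> bool" where
  "step n X t = (\<lambda>(S, R, \<Gamma>) (S', R', \<Gamma>').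
     \<not> derives n X S' R' \<Gamma>' \<and> S \<subseteq> S' \<and> set_mset R \<subseteq> set_mset R' \<and>
     (\<forall>x \<phi>. (x, \<phi>) \<in># \<Gamma> \<longrightarrow> (x, \<phi>) \<in># \<Gamma>' \<or> consumable \<phi> \<and> (\<exists>y. t = Reduce x \<phi> y)) \<and>
     fulfilled n X t (S, R, \<Gamma>) (S', R', \<Gamma>'))"

section \<open>Extending an underivable sequent by one task\<close>

lemma ex_fresh: "\<exists>y. fresh y R \<Gamma>"
proof -
  have "finite (labels_ratom a)" for a by (cases a) auto
  then have "finite ((\<Union>a \<in> set_mset R. labels_ratom a) \<union> fst ` set_mset \<Gamma>)" by auto
  then show ?thesis unfolding fresh_def using ex_new_if_finite infinite_UNIV_nat by blast
qed

text \<open>Were all premises of the matching rule derivable, so would be the sequent; an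
  underivable premise is the next state. If the guard of the rule fails, \<open>reduced\<close> is
  vacuous and the state stays as it is.\<close>

lemma ex_step_reduce:
  assumes nd: "\<not> derives n X S R \<Gamma>" and mem: "(x, \<phi>) \<in># \<Gamma>"
  shows "\<exists>s'. step n X (Reduce x \<phi> y) (S, R, \<Gamma>) s'"
proof -
  obtain \<Gamma>0 where \<Gamma>: "\<Gamma> = add_mset (x, \<phi>) \<Gamma>0" using mem by (meson multi_member_split)
  obtain z where z: "fresh z R \<Gamma>" using ex_fresh by blast
  have stay: ?thesis if "reduced n R R \<Gamma> x y \<phi>"
    using that nd by (intro exI[of _ "(S, R, \<Gamma>)"]) (simp add: step_def)
  show ?thesis
  proof (cases \<phi>)
    case (Disj a b)
    have "\<not> derives n X S R (add_mset (x, a) (add_mset (x, b) \<Gamma>0))"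
      using nd disj_rule unfolding \<Gamma> Disj by blast
    then show ?thesis
      by (intro exI[of _ "(S, R, add_mset (x, a) (add_mset (x, b) \<Gamma>0))"]) (simp add: step_def \<Gamma> Disj)
  next
    case (Conj a b)
    have "\<not> derives n X S R (add_mset (x, a) \<Gamma>0) \<or> \<not> derives n X S R (add_mset (x, b) \<Gamma>0)"
      using nd conj_rule unfolding \<Gamma> Conj by blast
    then show ?thesis
    proof
      assume "\<not> derives n X S R (add_mset (x, a) \<Gamma>0)"
      then show ?thesis
        by (intro exI[of _ "(S, R, add_mset (x, a) \<Gamma>0)"]) (simp add: step_def \<Gamma> Conj)
    next
      assume "\<not> derives n X S R (add_mset (x, b) \<Gamma>0)"
      then show ?thesis
        by (intro exI[of _ "(S, R, add_mset (x, b) \<Gamma>0)"]) (simp add: step_def \<Gamma> Conj)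
    qed
  next
    case (Box a)
    have "\<not> derives n X S (add_mset (RBox x z) R) (add_mset (z, a) \<Gamma>0)"
      using nd z box_rule unfolding \<Gamma> Box by blast
    then show ?thesis
      by (intro exI[of _ "(S, add_mset (RBox x z) R, add_mset (z, a) \<Gamma>0)"])
        (auto simp: step_def \<Gamma> Box)
  next
    case (Dia a)
    show ?thesis
    proof (cases "path_dia n R x y")
      case True
      then have "\<not> derives n X S R (add_mset (x, \<phi>) (add_mset (y, a) \<Gamma>0))"
        using nd dia_rule unfolding \<Gamma> Dia by blast
      then show ?thesis
        by (intro exI[of _ "(S, R, add_mset (x, \<phi>) (add_mset (y, a) \<Gamma>0))"])
          (simp add: step_def \<Gamma> Dia)
    qed (rule stay, simp add: Dia)
  next
    case (Stit i a)
    show ?thesis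
    proof (cases "i \<in> Ag n")
      case True
      then have "\<not> derives n X S (add_mset (RStit i x z) R) (add_mset (z, a) \<Gamma>0)"
        using nd z stit_rule unfolding \<Gamma> Stit by blast
      then show ?thesis
        by (intro exI[of _ "(S, add_mset (RStit i x z) R, add_mset (z, a) \<Gamma>0)"])
          (auto simp: step_def \<Gamma> Stit)
    qed (rule stay, simp add: Stit)
  next
    case (DStit i a)
    show ?thesis
    proof (cases "i \<in> Ag n \<and> path_stit i R x y")
      case True
      then have "\<not> derives n X S R (add_mset (x, \<phi>) (add_mset (y, a) \<Gamma>0))"
        using nd dstit_rule unfolding \<Gamma> DStit by blast
      then show ?thesis
        by (intro exI[of _ "(S, R, add_mset (x, \<phi>) (add_mset (y, a) \<Gamma>0))"])
          (simp add: step_def \<Gamma> DStit)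
    qed (rule stay, use DStit in auto)
  next
    case (Ought i a)
    show ?thesis
    proof (cases "i \<in> Ag n")
      case True
      then have "\<not> derives n X S (add_mset (ROught i x z) R) (add_mset (z, a) \<Gamma>0)"
        using nd z ought_rule unfolding \<Gamma> Ought by blast
      then show ?thesis
        by (intro exI[of _ "(S, add_mset (ROught i x z) R, add_mset (z, a) \<Gamma>0)"])
          (auto simp: step_def \<Gamma> Ought)
    qed (rule stay, simp add: Ought)
  next
    case (Perm i a)
    show ?thesis
    proof (cases "i \<in> Ag n \<and> ROught i x y \<in># R")
      case True
      then obtain R0 where R: "R = add_mset (ROught i x y) R0" by (meson multi_member_split)
      have "\<not> derives n X S R (add_mset (x, \<phi>) (add_mset (y, a) \<Gamma>0))"
        using nd True perm_rule unfolding \<Gamma> Perm R by blast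
      then show ?thesis
        by (intro exI[of _ "(S, R, add_mset (x, \<phi>) (add_mset (y, a) \<Gamma>0))"])
          (simp add: step_def \<Gamma> Perm)
    qed (rule stay, use Perm in auto)
  qed (rule stay, simp)+
qed

text \<open>An already fulfilled task changes nothing. For the remaining structural tasks, the
  negation of \<open>fulfilled\<close> supplies exactly the conditions under which the rule
  applies.\<close>

lemma ex_step:
  assumes nd: "\<not> derives n X S R \<Gamma>"
  shows "\<exists>s'. step n X t (S, R, \<Gamma>) s'"
proof (cases "fulfilled n X t (S, R, \<Gamma>) (S, R, \<Gamma>)")
  case True
  with nd show ?thesis by (intro exI[of _ "(S, R, \<Gamma>)"]) (simp add: step_def)
next
  case False
  obtain y where y: "fresh y R \<Gamma>" using ex_fresh by blast
  have add: ?thesis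
    if "\<not> derives n X S (add_mset a R) \<Gamma>" "fulfilled n X t (S, R, \<Gamma>) (S, add_mset a R, \<Gamma>)" for a
    using that by (intro exI[of _ "(S, add_mset a R, \<Gamma>)"]) (auto simp: step_def)
  show ?thesis
  proof (cases t)
    case (Reduce x \<phi> y)
    with False ex_step_reduce[OF nd] show ?thesis by auto
  next
    case (Join xs)
    let ?R = "R + {#RStit j (xs ! j) y. j \<in># mset_set (Ag n)#}"
    have "\<not> derives n X S ?R \<Gamma>"
      using IOA_rule[OF y, of n "(!) xs" X S] False nd unfolding Join by auto
    then show ?thesis
      by (intro exI[of _ "(S, ?R, \<Gamma>)"]) (auto simp: step_def Join Ag_def)
  next
    case (Apply_D1 i x y z)
    with False have *: "i \<in> Ag n" "path_dia n R x y" "ROught i x z \<in># R" by auto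
    then obtain R0 where R: "R = add_mset (ROught i x z) R0" by (meson multi_member_split)
    \<comment> \<open>The rule reads the path off the context without its principal atom; ought
      atoms are never links of a path, so removing one is harmless.\<close>
    have "path_dia n R0 x y" using *(2) by (simp add: path_dia_def R)
    with D1_rule[OF *(1) this, of X S z \<Gamma>] nd
    have "\<not> derives n X S (add_mset (ROught i y z) R) \<Gamma>" by (auto simp: R add_mset_commute)
    then show ?thesis by (rule add) (simp add: Apply_D1)
  next
    case (Apply_D2 i x)
    with False nd D2_rule[OF _ _ y] have "\<not> derives n X S (add_mset (ROught i x y) R) \<Gamma>" by auto
    then show ?thesis by (rule add) (auto simp: Apply_D2)
  next
    case (Apply_D3 i x y)
    with False have *: "D3 \<in> X" "i \<in> Ag n" "ROught i x y \<in># R" by auto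
    then obtain R0 where R: "R = add_mset (ROught i x y) R0" by (meson multi_member_split)
    from D3_rule[OF *(1,2), of S x y R0 \<Gamma>] nd
    have "\<not> derives n X S (add_mset (RBox x y) R) \<Gamma>" by (auto simp: R add_mset_commute)
    then show ?thesis by (rule add) (simp add: Apply_D3)
  next
    case (Apply_D4 i x y z)
    with False have *: "D4 \<in> X" "i \<in> Ag n" "path_stit i R y z" "ROught i x y \<in># R" by auto
    then obtain R0 where R: "R = add_mset (ROught i x y) R0" by (meson multi_member_split)
    have "path_stit i R0 y z" using *(3) by (simp add: path_stit_def R)
    with D4_rule[OF *(1,2) this, of S x \<Gamma>] nd
    have "\<not> derives n X S (add_mset (ROught i x z) R) \<Gamma>" by (auto simp: R add_mset_commute)
    then show ?thesis by (rule add) (simp add: Apply_D4)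
  next
    case (Apply_D5_1 i x)
    with False nd D5_1_rule[OF _ _ y]
    have "\<not> derives n X (insert (i, x, y) S) (add_mset (ROught i x y) R) \<Gamma>" by auto
    then show ?thesis
      by (intro exI[of _ "(insert (i, x, y) S, add_mset (ROught i x y) R, \<Gamma>)"])
        (auto simp: step_def Apply_D5_1)
  next
    case (Apply_D5_2 i x y z)
    with False have "D5 \<in> X" "i \<in> Ag n" "(i, x, y) \<in> S" "path_stit i R y z" by auto
    with nd D5_2_rule have "\<not> derives n X S (add_mset (ROught i x z) R) \<Gamma>" by blast
    then show ?thesis by (rule add) (simp add: Apply_D5_2)
  qed
qed

text \<open>Decode numbers as pairs and drop the first component: each \<open>t\<close> has the
  infinitely many codes \<open>to_nat (j, t)\<close>.\<close>

lemma fair_enumeration: "\<exists>\<tau> :: nat \<Rightarrow> 'a :: countable. \<forall>t m. \<exists>k\<ge>m. \<tau> k = t"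
proof (intro exI[of _ "\<lambda>k. snd (from_nat k :: nat \<times> 'a)"] allI)
  fix t :: 'a and m
  have "inj (\<lambda>j :: nat. to_nat (j, t))" by (auto intro!: injI)
  then have "infinite (range (\<lambda>j :: nat. to_nat (j, t)))" by (simp add: finite_image_iff)
  then obtain k where "k \<ge> m" "k \<in> range (\<lambda>j :: nat. to_nat (j, t))"
    unfolding finite_nat_set_iff_bounded by (meson not_le)
  then show "\<exists>k\<ge>m. snd (from_nat k :: nat \<times> 'a) = t" by (auto intro!: exI[of _ k])
qed

subsection \<open>The limit model\<close>

text \<open>The closures mirror \<open>path_dia\<close> and \<open>path_stit\<close>, so (C1) and
  (C2) hold by construction, while (C3) and all conditions on the ought relations must come from
  tasks. All labels are worlds, even those that never occur; tasks range over them too. The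
  valuation makes every collected \<open>Neg p\<close> false.\<close>

definition limit_model :: "nat \<Rightarrow> ratom set \<Rightarrow> (label \<times> 'p fm) set \<Rightarrow> (label, 'p) model" where
  "limit_model n A G =
     \<lparr>worlds = UNIV,
      rel_box = {(x, y). RBox x y \<in> A \<or> RBox y x \<in> A \<or>
                   (\<exists>j\<in>Ag n. RStit j x y \<in> A \<or> RStit j y x \<in> A)}\<^sup>*,
      rel_stit = (\<lambda>i. {(x, y). RStit i x y \<in> A \<or> RStit i y x \<in> A}\<^sup>*),
      rel_ought = (\<lambda>i. {(x, y). ROught i x y \<in> A}),
      val = (\<lambda>p. {x. (x, Neg p) \<in> G})\<rparr>"

lemma equiv_rtrancl: "sym r \<Longrightarrow> equiv UNIV (r\<^sup>*)"
  by (simp add: equiv_def refl_rtrancl sym_rtrancl trans_rtrancl)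

lemma path_dia_mono:
  "path_dia n R x y \<Longrightarrow> set_mset R \<subseteq> set_mset R' \<Longrightarrow> path_dia n R' x y"
  unfolding path_dia_def by (erule rtranclp_mono[THEN predicate2D, rotated]) blast

lemma path_stit_mono:
  "path_stit i R x y \<Longrightarrow> set_mset R \<subseteq> set_mset R' \<Longrightarrow> path_stit i R' x y"
  unfolding path_stit_def by (erule rtranclp_mono[THEN predicate2D, rotated]) blast

context
  fixes n :: nat and X :: "dprop set" and \<tau> :: "nat \<Rightarrow> 'p task"
    and S :: "nat \<Rightarrow> (nat \<times> label \<times> label) set" and R :: "nat \<Rightarrow> ratom multiset"
    and \<Gamma> :: "nat \<Rightarrow> (label \<times> 'p fm) multiset"
  assumes underivable: "\<And>k. \<not> derives n X (S k) (R k) (\<Gamma> k)"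
    and steps: "\<And>k. step n X (\<tau> k) (S k, R k, \<Gamma> k) (S (Suc k), R (Suc k), \<Gamma> (Suc k))"
    and fair: "\<And>t m. \<exists>k\<ge>m. \<tau> k = t"
begin

section \<open>Monotonicity and persistence along the chain\<close>

lemma S_mono: "k \<le> l \<Longrightarrow> S k \<subseteq> S l"
proof (rule lift_Suc_mono_le[of S])
  show "S j \<subseteq> S (Suc j)" for j using steps[of j] by (auto simp: step_def)
qed

lemma R_mono: "k \<le> l \<Longrightarrow> set_mset (R k) \<subseteq> set_mset (R l)"
proof (rule lift_Suc_mono_le[of "\<lambda>k. set_mset (R k)"])
  show "set_mset (R j) \<subseteq> set_mset (R (Suc j))" for j using steps[of j] by (auto simp: step_def)
qed

text \<open>At the step where the formula disappears it is still present beforehand and the task is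
  a \<open>Reduce\<close> on it. Hence it was reduced just then.\<close>

lemma persistent:
  assumes "(x, \<phi>) \<in># \<Gamma> k" "k \<le> l"
  shows "(x, \<phi>) \<in># \<Gamma> l \<or>
    consumable \<phi> \<and> (\<exists>j\<ge>k. \<exists>y. (x, \<phi>) \<in># \<Gamma> j \<and> \<tau> j = Reduce x \<phi> y)"
  using assms(2)
proof (induction l rule: dec_induct)
  case base
  then show ?case using assms(1) by blast
next
  case (step l)
  have "(x, \<phi>) \<in># \<Gamma> l \<Longrightarrow> (x, \<phi>) \<in># \<Gamma> (Suc l) \<or> consumable \<phi> \<and> (\<exists>y. \<tau> l = Reduce x \<phi> y)"
    using steps[of l] by (auto simp: step_def)
  with step show ?case by blast
qed

lemma fulfilled_eventually:
  "\<exists>k\<ge>m. fulfilled n X t (S k, R k, \<Gamma> k) (S (Suc k), R (Suc k), \<Gamma> (Suc k))"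
proof -
  obtain k where "k \<ge> m" "\<tau> k = t" using fair by blast
  then show ?thesis using steps[of k] by (auto simp: step_def)
qed

lemma reduced_eventually:
  assumes "(x, \<phi>) \<in># \<Gamma> k"
  shows "\<exists>j y. reduced n (R j) (R (Suc j)) (\<Gamma> (Suc j)) x y \<phi>"
proof -
  \<comment> \<open>The target \<open>0\<close> is arbitrary: only some reduction is wanted,
    possibly an earlier one that removed the formula.\<close>
  obtain l where l: "l \<ge> k" "\<tau> l = Reduce x \<phi> 0" using fair by blast
  with persistent[OF assms l(1)]
  obtain j y where "(x, \<phi>) \<in># \<Gamma> j" "\<tau> j = Reduce x \<phi> y" by blast
  then show ?thesis using steps[of j] by (auto simp: step_def)
qed

text \<open>A formula that no rule removes is present whenever its tasks return. So the target can
  be prescribed, and so can a stage after which the guarding path or atom exists.\<close>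

lemma reduced_at_eventually:
  assumes "(x, \<phi>) \<in># \<Gamma> k" "\<not> consumable \<phi>"
  shows "\<exists>j\<ge>m. reduced n (R j) (R (Suc j)) (\<Gamma> (Suc j)) x y \<phi>"
proof -
  obtain l where l: "l \<ge> max k m" "\<tau> l = Reduce x \<phi> y" using fair by blast
  with persistent[OF assms(1), of l] assms(2) have "(x, \<phi>) \<in># \<Gamma> l" by auto
  with l steps[of l] have "reduced n (R l) (R (Suc l)) (\<Gamma> (Suc l)) x y \<phi>" by (auto simp: step_def)
  with l(1) show ?thesis by auto
qed

definition limit_atoms :: "ratom set" where "limit_atoms = (\<Union>k. set_mset (R k))"
definition limit_formulas :: "(label \<times> 'p fm) set" where "limit_formulas = (\<Union>k. set_mset (\<Gamma> k))"

abbreviation limit :: "(label, 'p) model" where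
  "limit \<equiv> limit_model n limit_atoms limit_formulas"

lemma limit_atomsI: "a \<in># R k \<Longrightarrow> a \<in> limit_atoms"
  by (auto simp: limit_atoms_def)

lemma limit_formulasI: "f \<in># \<Gamma> k \<Longrightarrow> f \<in> limit_formulas"
  by (auto simp: limit_formulas_def)

lemma limit_ought_iff: "(x, y) \<in> rel_ought limit i \<longleftrightarrow> ROught i x y \<in> limit_atoms"
  by (simp add: limit_model_def)

lemma limit_ought:
  assumes "(x, y) \<in> rel_ought limit i"
  shows "\<exists>k. \<forall>l\<ge>k. ROught i x y \<in># R l"
proof -
  obtain k where "ROught i x y \<in># R k"
    using assms[unfolded limit_ought_iff] by (auto simp: limit_atoms_def)
  then show ?thesis by (intro exI[of _ k] allI impI) (rule R_mono[THEN subsetD])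
qed

text \<open>A chain uses finitely many atoms, all present at a common stage. Stating the path for
  all later stages allows several such conditions to be met together at one late task.\<close>

lemma limit_box:
  assumes "(x, y) \<in> rel_box limit"
  shows "\<exists>k. \<forall>l\<ge>k. path_dia n (R l) x y"
proof -
  have "\<exists>k. path_dia n (R k) x y"
    using assms unfolding limit_model_def frame.simps
  proof (induction rule: rtrancl_induct)
    case base
    then show ?case by (auto simp: path_dia_def)
  next
    case (step y z)
    then obtain k where k: "path_dia n (R k) x y" by blast
    from step(2) obtain l where "RBox y z \<in># R l \<or> RBox z y \<in># R l \<or>
        (\<exists>j\<in>Ag n. RStit j y z \<in># R l \<or> RStit j z y \<in># R l)"
      by (auto simp: limit_atoms_def)
    then have "path_dia n (R l) y z" by (auto simp: path_dia_def)
    then have "path_dia n (R (max k l)) y z" by (rule path_dia_mono[OF _ R_mono]) simp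
    moreover have "path_dia n (R (max k l)) x y" using k by (rule path_dia_mono[OF _ R_mono]) simp
    ultimately show ?case unfolding path_dia_def
      by (intro exI[of _ "max k l"]) (rule rtranclp_trans)
  qed
  then obtain k where "path_dia n (R k) x y" by blast
  then show ?thesis by (intro exI[of _ k] allI impI) (rule path_dia_mono[OF _ R_mono])
qed

lemma limit_stit:
  assumes "(x, y) \<in> rel_stit limit i"
  shows "\<exists>k. \<forall>l\<ge>k. path_stit i (R l) x y"
proof -
  have "\<exists>k. path_stit i (R k) x y"
    using assms unfolding limit_model_def frame.simps
  proof (induction rule: rtrancl_induct)
    case base
    then show ?case by (auto simp: path_stit_def)
  next
    case (step y z)
    then obtain k where k: "path_stit i (R k) x y" by blast
    from step(2) obtain l where "RStit i y z \<in># R l \<or> RStit i z y \<in># R l"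
      by (auto simp: limit_atoms_def)
    then have "path_stit i (R l) y z" by (auto simp: path_stit_def)
    then have "path_stit i (R (max k l)) y z" by (rule path_stit_mono[OF _ R_mono]) simp
    moreover have "path_stit i (R (max k l)) x y" using k by (rule path_stit_mono[OF _ R_mono]) simp
    ultimately show ?case unfolding path_stit_def
      by (intro exI[of _ "max k l"]) (rule rtranclp_trans)
  qed
  then obtain k where "path_stit i (R k) x y" by blast
  then show ?thesis by (intro exI[of _ k] allI impI) (rule path_stit_mono[OF _ R_mono])
qed

section \<open>Frame conditions and truth in the limit model\<close>

lemma limit_holds:
  "a \<in> limit_atoms \<Longrightarrow> ratom_holds limit id a"
  by (cases a) (auto simp: limit_model_def)

lemma DS_frame_limit: "DS_frame n limit"
  unfolding DS_frame_def
proof (intro conjI ballI allI impI)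
  show "worlds limit \<noteq> {}" by (simp add: limit_model_def)
  show "equiv (worlds limit) (rel_box limit)"
    unfolding limit_model_def frame.simps by (rule equiv_rtrancl) (auto simp: sym_def)
next
  fix i assume i: "i \<in> Ag n"
  show "rel_ought limit i \<subseteq> worlds limit \<times> worlds limit" by (simp add: limit_model_def)
  show "rel_stit limit i \<subseteq> rel_box limit"
    unfolding limit_model_def frame.simps by (rule rtrancl_mono) (use i in auto)
  show "equiv (worlds limit) (rel_stit limit i)"
    unfolding limit_model_def frame.simps by (rule equiv_rtrancl) (auto simp: sym_def)
next
  fix w u assume u: "\<forall>i\<in>Ag n. u i \<in> rel_box limit `` {w}"
  \<comment> \<open>The range up to \<open>Suc n\<close> makes position \<open>j\<close> belong to
    agent \<open>j\<close>, the last one included.\<close>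
  define xs where "xs = map u [0..<Suc n]"
  have xs: "xs ! j = u j" if "j \<in> Ag n" for j
    using that unfolding xs_def by (subst nth_map) (auto simp: Ag_def simp del: upt_Suc)
  have "equiv UNIV (rel_box limit)"
    unfolding limit_model_def frame.simps by (rule equiv_rtrancl) (auto simp: sym_def)
  then have uu: "(u i, u j) \<in> rel_box limit" if "i \<in> Ag n" "j \<in> Ag n" for i j
    using u that by (meson Image_singleton_iff equiv_def symD transD)
  have "\<exists>k. \<forall>l\<ge>k. path_dia n (R l) (xs ! j) (xs ! Suc j)" if "j \<in> {1..<n}" for j
    using limit_box[OF uu[of j "Suc j"]] that xs[of j] xs[of "Suc j"] by (auto simp: Ag_def)
  then obtain K where K: "\<And>j l. j \<in> {1..<n} \<Longrightarrow> l \<ge> K j \<Longrightarrow> path_dia n (R l) (xs ! j) (xs ! Suc j)"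
    by metis
  \<comment> \<open>A stage at which all neighbour paths exist; \<open>insert 0\<close> keeps the
    set nonempty when \<open>n = 1\<close>.\<close>
  obtain l where l: "l \<ge> Max (insert 0 (K ` {1..<n}))"
    and f: "fulfilled n X (Join xs) (S l, R l, \<Gamma> l) (S (Suc l), R (Suc l), \<Gamma> (Suc l))"
    using fulfilled_eventually by blast
  have "K j \<le> l" if "j \<in> {1..<n}" for j using that l by auto
  with f K obtain y where "\<forall>j\<in>Ag n. RStit j (xs ! j) y \<in># R (Suc l)" by auto
  then have "y \<in> (\<Inter>i\<in>Ag n. rel_stit limit i `` {u i})"
    using xs by (auto simp: limit_model_def dest!: limit_atomsI)
  then show "(\<Inter>i\<in>Ag n. rel_stit limit i `` {u i}) \<noteq> {}" by blast
next
  fix i w v u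
  assume i: "i \<in> Ag n" and *: "(w, v) \<in> rel_box limit \<and> (w, u) \<in> rel_ought limit i"
  obtain k1 where k1: "\<And>l. l \<ge> k1 \<Longrightarrow> path_dia n (R l) w v" using limit_box * by blast
  obtain k2 where k2: "\<And>l. l \<ge> k2 \<Longrightarrow> ROught i w u \<in># R l" using limit_ought * by blast
  obtain l where "l \<ge> max k1 k2"
    "fulfilled n X (Apply_D1 i w v u) (S l, R l, \<Gamma> l) (S (Suc l), R (Suc l), \<Gamma> (Suc l))"
    using fulfilled_eventually by blast
  with i k1 k2 have "ROught i v u \<in># R (Suc l)" by auto
  then show "(v, u) \<in> rel_ought limit i" by (auto simp: limit_ought_iff intro: limit_atomsI)
qed

lemma has_dprop_limit:
  assumes "d \<in> X"
  shows "has_dprop n limit d"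
proof (cases d)
  case D2
  have "\<exists>v. (w, v) \<in> rel_ought limit i" if "i \<in> Ag n" for i w
    using fulfilled_eventually[of 0 "Apply_D2 i w"] assms D2 that
    by (auto simp: limit_ought_iff intro: limit_atomsI)
  then show ?thesis by (simp add: D2 limit_model_def)
next
  case D3
  have "(w, v) \<in> rel_box limit" if i: "i \<in> Ag n" and wv: "(w, v) \<in> rel_ought limit i" for i w v
  proof -
    obtain k where k: "\<And>l. l \<ge> k \<Longrightarrow> ROught i w v \<in># R l" using limit_ought[OF wv] by blast
    obtain l where "l \<ge> k"
      "fulfilled n X (Apply_D3 i w v) (S l, R l, \<Gamma> l) (S (Suc l), R (Suc l), \<Gamma> (Suc l))"
      using fulfilled_eventually by blast
    with k i assms D3 have "RBox w v \<in># R (Suc l)" by auto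
    then show ?thesis using limit_holds[OF limit_atomsI] by fastforce
  qed
  then show ?thesis by (simp add: D3)
next
  case D4
  have "(w, u) \<in> rel_ought limit i"
    if i: "i \<in> Ag n" and wv: "(w, v) \<in> rel_ought limit i" and vu: "(v, u) \<in> rel_stit limit i" for i w v u
  proof -
    obtain k1 where k1: "\<And>l. l \<ge> k1 \<Longrightarrow> path_stit i (R l) v u" using limit_stit[OF vu] by blast
    obtain k2 where k2: "\<And>l. l \<ge> k2 \<Longrightarrow> ROught i w v \<in># R l" using limit_ought[OF wv] by blast
    obtain l where "l \<ge> max k1 k2"
      "fulfilled n X (Apply_D4 i w v u) (S l, R l, \<Gamma> l) (S (Suc l), R (Suc l), \<Gamma> (Suc l))"
      using fulfilled_eventually by blast
    with k1 k2 i assms D4 have "ROught i w u \<in># R (Suc l)" by auto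
    then show ?thesis by (auto simp: limit_ought_iff intro: limit_atomsI)
  qed
  then show ?thesis unfolding D4 has_dprop.simps by blast
next
  case D5
  have "\<exists>v. (w, v) \<in> rel_ought limit i \<and> (\<forall>u. (v, u) \<in> rel_stit limit i \<longrightarrow> (w, u) \<in> rel_ought limit i)"
    if i: "i \<in> Ag n" for i w
  proof -
    \<comment> \<open>The witness \<open>v\<close> is fixed before any \<open>u\<close>. Being
      recorded in \<open>S\<close>, it stays usable, and each member \<open>u\<close> of its choice
      cell is treated by a later task for the same \<open>v\<close>.\<close>
    obtain m v where v: "(i, w, v) \<in> S m" "ROught i w v \<in># R m"
      using fulfilled_eventually[of 0 "Apply_D5_1 i w"] assms D5 i by auto
    have "(w, u) \<in> rel_ought limit i" if vu: "(v, u) \<in> rel_stit limit i" for u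
    proof -
      obtain k where k: "\<And>l. l \<ge> k \<Longrightarrow> path_stit i (R l) v u" using limit_stit[OF vu] by blast
      obtain l where l: "l \<ge> max k m"
        "fulfilled n X (Apply_D5_2 i w v u) (S l, R l, \<Gamma> l) (S (Suc l), R (Suc l), \<Gamma> (Suc l))"
        using fulfilled_eventually by blast
      then have "(i, w, v) \<in> S l" using v(1) S_mono[of m l] by auto
      with l k i assms D5 have "ROught i w u \<in># R (Suc l)" by auto
      then show ?thesis by (auto simp: limit_ought_iff intro: limit_atomsI)
    qed
    with v(2) show ?thesis by (auto simp: limit_ought_iff intro: limit_atomsI)
  qed
  then show ?thesis unfolding D5 has_dprop.simps by (simp add: limit_model_def)
qed

lemma DSX_model_limit: "DSX_model n X limit"
  using DS_frame_limit has_dprop_limit by (simp add: DSX_model_def DSX_frame_def limit_model_def)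

text \<open>For connectives and universal modalities one reduction leaves behind the needed parts,
  with a witness label in the modal case. For existential modalities, each successor in the limit is
  visible from some stage on, and a later reduction puts the body there. Membership in
  \<open>lang n\<close> matters because reductions for indices outside \<open>Ag n\<close> are
  vacuous.\<close>

lemma limit_refutes:
  "(x, \<phi>) \<in> limit_formulas \<Longrightarrow> \<phi> \<in> lang n \<Longrightarrow> \<not> sat limit x \<phi>"
proof (induction \<phi> arbitrary: x)
  case (Pos p)
  have False if neg: "(x, Neg p) \<in> limit_formulas"
  proof -
    obtain k l where "(x, Pos p) \<in># \<Gamma> k" "(x, Neg p) \<in># \<Gamma> l"
      using Pos neg by (auto simp: limit_formulas_def)
    \<comment> \<open>Literals are never removed, so both meet at a common stage, whose sequent
      would be an instance of (id).\<close>
    then have *: "(x, Pos p) \<in># \<Gamma> (max k l)" "(x, Neg p) \<in># \<Gamma> (max k l)"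
      using persistent[of x "Pos p" k "max k l"] persistent[of x "Neg p" l "max k l"] by auto
    then obtain \<Delta> where \<Delta>: "\<Gamma> (max k l) = add_mset (x, Pos p) \<Delta>" by (meson multi_member_split)
    with *(2) have "(x, Neg p) \<in># \<Delta>" by auto
    then obtain \<Delta>' where "\<Delta> = add_mset (x, Neg p) \<Delta>'" by (meson multi_member_split)
    with \<Delta> underivable[of "max k l"] show False by (simp add: id_rule)
  qed
  then show ?case by (auto simp: limit_model_def)
next
  case (Neg p)
  then show ?case by (simp add: limit_model_def)
next
  case (Disj \<phi> \<psi>)
  then obtain k where "(x, Disj \<phi> \<psi>) \<in># \<Gamma> k" by (auto simp: limit_formulas_def)
  from reduced_eventually[OF this] Disj show ?case by (auto simp: lang_def dest: limit_formulasI)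
next
  case (Conj \<phi> \<psi>)
  then obtain k where "(x, Conj \<phi> \<psi>) \<in># \<Gamma> k" by (auto simp: limit_formulas_def)
  from reduced_eventually[OF this] Conj show ?case by (auto simp: lang_def dest: limit_formulasI)
next
  case (Box \<phi>)
  then obtain k where "(x, Box \<phi>) \<in># \<Gamma> k" by (auto simp: limit_formulas_def)
  from reduced_eventually[OF this]
  obtain z where "RBox x z \<in> limit_atoms" "(z, \<phi>) \<in> limit_formulas"
    by (auto dest: limit_formulasI limit_atomsI)
  with limit_holds[OF this(1)] Box show ?case by (auto simp: lang_def)
next
  case (Dia \<phi>)
  then obtain k where k: "(x, Dia \<phi>) \<in># \<Gamma> k" by (auto simp: limit_formulas_def)
  have "\<not> sat limit y \<phi>" if xy: "(x, y) \<in> rel_box limit" for y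
  proof -
    obtain m where m: "\<And>l. l \<ge> m \<Longrightarrow> path_dia n (R l) x y" using limit_box[OF xy] by blast
    have "(y, \<phi>) \<in> limit_formulas"
      using reduced_at_eventually[OF k, of m y] m by (auto dest: limit_formulasI)
    with Dia show ?thesis by (simp add: lang_def)
  qed
  then show ?case by auto
next
  case (Stit i \<phi>)
  then obtain k where "(x, Stit i \<phi>) \<in># \<Gamma> k" by (auto simp: limit_formulas_def)
  from reduced_eventually[OF this] Stit.prems(2)
  obtain z where "RStit i x z \<in> limit_atoms" "(z, \<phi>) \<in> limit_formulas"
    by (auto simp: lang_def dest: limit_formulasI limit_atomsI)
  with limit_holds[OF this(1)] Stit show ?case by (auto simp: lang_def)
next
  case (DStit i \<phi>)
  then obtain k where k: "(x, DStit i \<phi>) \<in># \<Gamma> k" by (auto simp: limit_formulas_def)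
  have i: "i \<in> Ag n" using DStit.prems(2) by (simp add: lang_def)
  have "\<not> sat limit y \<phi>" if xy: "(x, y) \<in> rel_stit limit i" for y
  proof -
    obtain m where m: "\<And>l. l \<ge> m \<Longrightarrow> path_stit i (R l) x y" using limit_stit[OF xy] by blast
    have "(y, \<phi>) \<in> limit_formulas"
      using reduced_at_eventually[OF k, of m y] m i by (auto dest: limit_formulasI)
    with DStit show ?thesis by (simp add: lang_def)
  qed
  then show ?case by auto
next
  case (Ought i \<phi>)
  then obtain k where "(x, Ought i \<phi>) \<in># \<Gamma> k" by (auto simp: limit_formulas_def)
  from reduced_eventually[OF this] Ought.prems(2)
  obtain z where "ROught i x z \<in> limit_atoms" "(z, \<phi>) \<in> limit_formulas"
    by (auto simp: lang_def dest: limit_formulasI limit_atomsI)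
  with limit_holds[OF this(1)] Ought show ?case by (auto simp: lang_def)
next
  case (Perm i \<phi>)
  then obtain k where k: "(x, Perm i \<phi>) \<in># \<Gamma> k" by (auto simp: limit_formulas_def)
  have i: "i \<in> Ag n" using Perm.prems(2) by (simp add: lang_def)
  have "\<not> sat limit y \<phi>" if xy: "(x, y) \<in> rel_ought limit i" for y
  proof -
    obtain m where m: "\<And>l. l \<ge> m \<Longrightarrow> ROught i x y \<in># R l" using limit_ought[OF xy] by blast
    have "(y, \<phi>) \<in> limit_formulas"
      using reduced_at_eventually[OF k, of m y] m i by (auto dest: limit_formulasI)
    with Perm show ?thesis by (simp add: lang_def)
  qed
  then show ?case by auto
qed

lemma limit_not_sat_sequent:
  assumes "(R 0, \<Gamma> 0) \<in> sequents n"
  shows "\<not> sat_sequent limit id (R 0, \<Gamma> 0)"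
  using assms limit_holds[OF limit_atomsI] limit_refutes[OF limit_formulasI]
  by (fastforce simp: sat_sequent_def sequents_def)

end

section \<open>Building the chain and transporting the countermodel\<close>

lemma ex_countermodel:
  fixes \<Lambda> :: "'p :: countable sequent"
  assumes "\<Lambda> \<in> sequents n" "\<not> derivable n X \<Lambda>"
  shows "\<exists>M :: (label, 'p) model. DSX_model n X M \<and> worlds M = UNIV \<and> \<not> sat_sequent M id \<Lambda>"
proof -
  obtain \<tau> :: "nat \<Rightarrow> 'p task" where fair: "\<And>t m. \<exists>k\<ge>m. \<tau> k = t"
    using fair_enumeration by blast
  define nd where "nd = (\<lambda>(S, R, \<Gamma> :: (label \<times> 'p fm) multiset). \<not> derives n X S R \<Gamma>)"
  have nd_step: "nd s'" if "step n X t s s'" for t s s'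
    using that by (auto simp: step_def nd_def split: prod.splits)
  \<comment> \<open>Underivability is the invariant of the dependent choice; the condition at
    \<open>k = 0\<close> pins the start to the given sequent with \<open>S\<close> empty, as at the
    root of a derivation.\<close>
  have "\<exists>st. \<forall>k. (nd (st k) \<and> (k = 0 \<longrightarrow> st k = ({}, \<Lambda>))) \<and> step n X (\<tau> k) (st k) (st (Suc k))"
  proof (rule dependent_nat_choice)
    show "\<exists>s. nd s \<and> (0 = 0 \<longrightarrow> s = ({}, \<Lambda>))"
      using assms(2) by (cases \<Lambda>) (simp add: nd_def derivable_def)
  next
    fix s and k :: nat assume "nd s \<and> (k = 0 \<longrightarrow> s = ({}, \<Lambda>))"
    then have "\<not> derives n X (fst s) (fst (snd s)) (snd (snd s))"
      by (simp add: nd_def case_prod_unfold)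
    from ex_step[OF this, of "\<tau> k"] obtain s' where "step n X (\<tau> k) s s'" by auto
    with nd_step show "\<exists>s'. (nd s' \<and> (Suc k = 0 \<longrightarrow> s' = ({}, \<Lambda>))) \<and> step n X (\<tau> k) s s'" by blast
  qed
  then obtain st where st: "\<And>k. nd (st k)" "st 0 = ({}, \<Lambda>)" "\<And>k. step n X (\<tau> k) (st k) (st (Suc k))"
    by blast
  define S R \<Gamma> where "S = (\<lambda>k. fst (st k))" and "R = (\<lambda>k. fst (snd (st k)))"
    and "\<Gamma> = (\<lambda>k. snd (snd (st k)))"
  have st_eq: "st k = (S k, R k, \<Gamma> k)" for k by (simp add: S_def R_def \<Gamma>_def)
  have underivable: "\<not> derives n X (S k) (R k) (\<Gamma> k)" for k
    using st(1)[of k] by (simp add: st_eq nd_def)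
  have steps: "step n X (\<tau> k) (S k, R k, \<Gamma> k) (S (Suc k), R (Suc k), \<Gamma> (Suc k))" for k
    using st(3)[of k] by (simp add: st_eq)
  have \<Lambda>: "\<Lambda> = (R 0, \<Gamma> 0)" using st(2) by (simp add: st_eq)
  note limit = underivable steps fair
  show ?thesis
    using DSX_model_limit[of n X S R \<Gamma>, OF limit]
      limit_not_sat_sequent[of n X S R \<Gamma>, OF limit] assms(1)
    by (intro exI conjI) (auto simp: \<Lambda> limit_model_def)
qed

text \<open>The countermodel lives on the natural numbers while validity speaks of worlds in
  \<open>'w\<close>; an injection carries it over, with no points added.\<close>

theorem valid_imp_derivable:
  fixes \<Lambda> :: "'p :: countable sequent"
  assumes "\<Lambda> \<in> sequents n" "infinite (UNIV :: 'w set)" "valid TYPE('w) n X \<Lambda>"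
  shows "derivable n X \<Lambda>"
proof (rule ccontr)
  assume "\<not> derivable n X \<Lambda>"
  from ex_countermodel[OF assms(1) this]
  obtain M :: "(label, 'p) model" where M: "DSX_model n X M" "worlds M = UNIV" "\<not> sat_sequent M id \<Lambda>"
    by blast
  obtain f :: "nat \<Rightarrow> 'w" where "inj f"
    using infinite_countable_subset[OF assms(2)] by blast
  then have f: "inj f" "range f \<inter> {} = {}" by auto
  let ?N = "extend_model f {} M"
  have "DSX_model n X ?N" by (rule DSX_model_extend_model[OF f M(1)])
  moreover have "range f \<subseteq> worlds ?N" by (simp add: extend_model_def M(2))
  ultimately have "sat_sequent ?N f \<Lambda>" using assms(3) unfolding valid_def by blast
  moreover have "ratom_holds ?N f a" if "ratom_holds M id a" for a
    using that by (cases a) (auto simp: extend_model_def extend_rel_def)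
  ultimately have "sat_sequent M id \<Lambda>"
    by (auto simp: sat_sequent_def sat_extend_model[OF f])
  with M(3) show False ..
qed

theorem theorem4p6:
  fixes n :: nat and X :: "dprop set" and \<Lambda> :: "('p :: countable) sequent"
  assumes "n \<ge> 1"
    and "X \<subseteq> {D2, D3, D4, D5}"
    and "\<Lambda> \<in> sequents n"
    and "infinite (UNIV :: 'w set)"
  shows "derivable n X \<Lambda> \<longleftrightarrow> valid TYPE('w) n X \<Lambda>"
  using derivable_imp_valid[OF assms(1)] valid_imp_derivable[OF assms(3,4)] by blast

end
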